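(* Let $N\ge 1$ and $d\ge 1$, and consider bosons on a $d$-dimensional lattice with $N$ sites per unit cell and periodic boundary conditions, with momentum-space annihilation operators $b_{n,\vec k}$ ($n=1,\dots,N$) obeying canonical bosonic commutation relations. Let $R_+,R_-\ge 0$ be integers with $R_++R_-\le N$, and for $\sigma\in\{+,-\}$ let $u_\sigma(\vec k),v_\sigma(\vec k)$ be complex $R_\sigma\times N$ matrices satisfying, for all $\vec k$ and all $\sigma,\sigma'\in\{+,-\}$, $$u_\sigma(\vec k)u_{\sigma'}^\dagger(\vec k)-v_\sigma(\vec k)v_{\sigma'}^\dagger(\vec k)=\delta_{\sigma\sigma'}\mathbb{1}_{R_\sigma},\qquad u_\sigma(\vec k)v_{\sigma'}^T(-\vec k)-v_\sigma(\vec k)u_{\sigma'}^T(-\vec k)=0,$$ and such that the gauge-invariant combinations $u_\sigma^\dagger(\vec k)u_\sigma(\vec k)$, $v_\sigma^\dagger(\vec k)v_\sigma(\vec k)$ and $u_\sigma^\dagger(\vec k)v_\sigma(\vec k)$ depend smoothly on $\vec k$. Define $A_{m,\vec k,\sigma}=\sum_{n=1}^N\big(u_{mn,\sigma}(\vec k)b_{n,\vec k}+v_{mn,\sigma}(\vec k)b^\dagger_{n,-\vec k}\big)$ and $$H=\sum_{\vec k}\Big(\sum_{m=1}^{R_+}A^\dagger_{m,\vec k,+}A_{m,\vec k,+}-\sum_{m=1}^{R_-}A^\dagger_{m,\vec k,-}A_{m,\vec k,-}\Big),$$ and define the particle-number-conserving Hamiltonian $$\tilde H=\sum_{\vec k}\sum_{m,n=1}^N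 Q_{mn}(\vec k)\,b^\dagger_{m,\vec k}b_{n,\vec k},\qquad Q(\vec k)=u_+^\dagger(\vec k)u_+(\vec k)-u_-^\dagger(\vec k)u_-(\vec k).$$ Then there exists a continuous one-parameter family of quadratic bosonic Hamiltonians $H_\epsilon$, $\epsilon\in[0,1]$, with $H_0=H$ and $H_1=\tilde H$, such that for every $\epsilon\in[0,1]$: (1) $H_\epsilon$ is short-ranged in real space; (2) $H_\epsilon$ is dynamically stable; (3) the dynamical matrix of $H_\epsilon$ has a spectral gap around $\omega=\pm1/2$.
   Context: A quadratic bosonic Hamiltonian is written (up to a constant) in Bogoliubov–de Gennes (BdG) form $\frac12\sum_{\vec k}\phi_{\vec k}^\dagger h(\vec k)\phi_{\vec k}$ with Nambu vector $\phi_{\vec k}=(b_{1,\vec k},\dots,b_{N,\vec k},b^\dagger_{1,-\vec k},\dots,b^\dagger_{N,-\vec k})^T$ and Hermitian $2N\times 2N$ BdG matrix $h(\vec k)$. Its dynamical matrix is $D(\vec k)=\tau_z h(\vec k)$, where $\tau_z=\mathrm{diag}(\mathbb{1}_N,-\mathbb{1}_N)$; the Heisenberg equations read $\dot\phi=-i\tau_z h\phi$ and the eigenvalues of $D(\vec k)$ are the normal-mode frequencies $\omega$. The Hamiltonian is dynamically stable if for every $\vec k$, $D(\vec k)$ is diagonalizable with all eigenvalues real (no positive-definiteness is required). It is short-ranged in real space if its BdG matrix $h(\vec k)$ depends smoothly on $\vec k$. "The dynamical matrix has a spectral gap around $\omega=\pm1/2$" means that the eigenvalues of $D(\vec k)$,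 over all $\vec k$, stay bounded away from $+1/2$ and $-1/2$. *)

theory Defs
  imports "HOL-Analysis.Analysis" "Jordan_Normal_Form.Schur_Decomposition" "Jordan_Normal_Form.Char_Poly"
begin

text \<open>Momenta k range over a d-dimensional real space, modelled by a Euclidean space
type 'd (d = DIM('d) >= 1). The Brillouin zone is the torus obtained by identifying k with
k + 2 pi b for every basis vector b (reciprocal lattice written in coordinates where it is
2 pi Z^d); functions on the Brillouin zone are periodic functions on 'd.
C^n is defined via iterated partial derivatives along the coordinate directions.\<close>

fun Ck_fun :: "nat \<Rightarrow> ('d::euclidean_space \<Rightarrow> complex) \<Rightarrow> bool" where
  "Ck_fun 0 f = continuous_on UNIV f"
| "Ck_fun (Suc n) f = (continuous_on UNIV f \<and>
     (\<forall>b\<in>Basis. \<exists>g. (\<forall>x. ((\<lambda>t. f (x + t *\<^sub>R b)) has_vector_derivative g x) (at 0))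
                     \<and> Ck_fun n g))"

definition smooth_fun :: "('d::euclidean_space \<Rightarrow> complex) \<Rightarrow> bool" where
  "smooth_fun f \<longleftrightarrow> (\<forall>n. Ck_fun n f)"

definition smooth_mat :: "nat \<Rightarrow> nat \<Rightarrow> ('d::euclidean_space \<Rightarrow> complex mat) \<Rightarrow> bool" where
  "smooth_mat r c F \<longleftrightarrow> (\<forall>i<r. \<forall>j<c. smooth_fun (\<lambda>k. F k $$ (i,j)))"

definition bz_periodic :: "('d::euclidean_space \<Rightarrow> 'a) \<Rightarrow> bool" where
  "bz_periodic F \<longleftrightarrow> (\<forall>k. \<forall>b\<in>Basis. F (k + (2 * pi) *\<^sub>R b) = F k)"

definition tau_x :: "nat \<Rightarrow> complex mat" where
  "tau_x N = four_block_mat (0\<^sub>m N N) (1\<^sub>m N) (1\<^sub>m N) (0\<^sub>m N N)"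

definition tau_z :: "nat \<Rightarrow> complex mat" where
  "tau_z N = four_block_mat (1\<^sub>m N) (0\<^sub>m N N) (0\<^sub>m N N) (- 1\<^sub>m N)"

text \<open>A (translation-invariant, quadratic) bosonic Hamiltonian is given by its BdG matrix
h(k), a Hermitian 2N x 2N matrix for every k, with the built-in particle-hole redundancy
of the Nambu basis: h(-k) = tau_x h(k)^T tau_x.\<close>
definition is_bdg :: "nat \<Rightarrow> ('d::euclidean_space \<Rightarrow> complex mat) \<Rightarrow> bool" where
  "is_bdg N h \<longleftrightarrow> (\<forall>k. h k \<in> carrier_mat (2*N) (2*N) \<and> mat_adjoint (h k) = h k
                        \<and> h (-k) = tau_x N * transpose_mat (h k) * tau_x N)"

definition dyn_mat :: "nat \<Rightarrow> complex mat \<Rightarrow> complex mat" where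
  "dyn_mat N h = tau_z N * h"

definition diagonalizable :: "complex mat \<Rightarrow> bool" where
  "diagonalizable A \<longleftrightarrow> (\<exists>D. diagonal_mat D \<and> similar_mat A D)"

definition short_ranged :: "nat \<Rightarrow> ('d::euclidean_space \<Rightarrow> complex mat) \<Rightarrow> bool" where
  "short_ranged N h \<longleftrightarrow> smooth_mat (2*N) (2*N) h"

definition dyn_stable :: "nat \<Rightarrow> ('d::euclidean_space \<Rightarrow> complex mat) \<Rightarrow> bool" where
  "dyn_stable N h \<longleftrightarrow> (\<forall>k. diagonalizable (dyn_mat N (h k))
                         \<and> (\<forall>\<omega>. eigenvalue (dyn_mat N (h k)) \<omega> \<longrightarrow> \<omega> \<in> \<real>))"

definition gapped_half :: "nat \<Rightarrow> ('d::euclidean_space \<Rightarrow> complex mat) \<Rightarrow> bool" where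
  "gapped_half N h \<longleftrightarrow> (\<exists>\<delta>>0. \<forall>k \<omega>. eigenvalue (dyn_mat N (h k)) \<omega> \<longrightarrow>
                         cmod (\<omega> - 1/2) \<ge> \<delta> \<and> cmod (\<omega> + 1/2) \<ge> \<delta>)"

text \<open>sigma = True stands for +, sigma = False for -. The row vector of A_{m,k,sigma} in the
Nambu basis phi_k = (b_k, b^dagger_{-k}) is the m-th row of W_sigma(k) = [u_sigma(k) v_sigma(k)].\<close>
definition Wmat :: "nat \<Rightarrow> complex mat \<Rightarrow> complex mat \<Rightarrow> complex mat" where
  "Wmat N U V = four_block_mat U V (0\<^sub>m 0 N) (0\<^sub>m 0 N)"

text \<open>sum_k (sum_m A^dag_+ A_+ - sum_m A^dag_- A_-) = sum_k phi_k^dag M(k) phi_k.\<close>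
definition Mmat :: "nat \<Rightarrow> (bool \<Rightarrow> 'd \<Rightarrow> complex mat) \<Rightarrow> (bool \<Rightarrow> 'd \<Rightarrow> complex mat) \<Rightarrow> 'd \<Rightarrow> complex mat" where
  "Mmat N u v k = mat_adjoint (Wmat N (u True k) (v True k)) * Wmat N (u True k) (v True k)
                - mat_adjoint (Wmat N (u False k) (v False k)) * Wmat N (u False k) (v False k)"

text \<open>BdG matrix of H (so that H = 1/2 sum_k phi_k^dag h(k) phi_k + const).\<close>
definition bdg_H :: "nat \<Rightarrow> (bool \<Rightarrow> 'd::euclidean_space \<Rightarrow> complex mat) \<Rightarrow> (bool \<Rightarrow> 'd \<Rightarrow> complex mat) \<Rightarrow> 'd \<Rightarrow> complex mat" where
  "bdg_H N u v k = Mmat N u v k + tau_x N * transpose_mat (Mmat N u v (-k)) * tau_x N"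

definition Qmat :: "(bool \<Rightarrow> 'd \<Rightarrow> complex mat) \<Rightarrow> 'd \<Rightarrow> complex mat" where
  "Qmat u k = mat_adjoint (u True k) * u True k - mat_adjoint (u False k) * u False k"

definition bdg_Htilde :: "nat \<Rightarrow> (bool \<Rightarrow> 'd::euclidean_space \<Rightarrow> complex mat) \<Rightarrow> 'd \<Rightarrow> complex mat" where
  "bdg_Htilde N u k = four_block_mat (Qmat u k) (0\<^sub>m N N) (0\<^sub>m N N) (transpose_mat (Qmat u (-k)))"

end

theory Submission
  imports Defs "Jordan_Normal_Form.Jordan_Normal_Form_Existence" "Jordan_Normal_Form.Jordan_Normal_Form_Uniqueness"
begin

text \<open>The path is obtained by scaling every \<open>v\<close> by \<open>s = 1 - \<epsilon>\<close>. At each momentum, stack the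
rows of \<open>[u, s v]\<close> for both signs and of their particle-hole conjugates into a matrix \<open>W\<close>. Then
\<open>h = W\<^sup>* S W\<close> with a diagonal sign matrix \<open>S\<close>, so that \<open>D = \<tau>\<^sub>z h = X Y\<close> for \<open>X = \<tau>\<^sub>z W\<^sup>*\<close> and
\<open>Y = S W\<close>. The commutation relations give \<open>Y X = J P\<close>, where \<open>J\<close> is a Hermitian involution and
\<open>P = 1 + (1 - s\<^sup>2) diag(v v\<^sup>*, conj (v v\<^sup>*)) \<ge> 1\<close>. Since \<open>J P\<close> is self-adjoint for the inner product
defined by \<open>P\<close> and \<open>|<w, J w>| \<le> <w, P w>\<close>, its eigenvalues are real of modulus at least 1;
hence \<open>D\<close> is diagonalizable with real spectrum outside \<open>(-1, 0) \<union> (0, 1)\<close>.\<close>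

unbundle no inner_syntax and no vec_syntax

subsection \<open>Diagonalizability of products\<close>

lemma minus_vec_eq_zeroD:
  fixes v w :: "'a :: ab_group_add Matrix.vec"
  assumes v: "v \<in> carrier_vec n" and w: "w \<in> carrier_vec n" and eq: "v - w = 0\<^sub>v n"
  shows "v = w"
proof (rule eq_vecI)
  fix i assume i: "i < dim_vec w"
  have "(v - w) $ i = 0" using i w unfolding eq by simp
  then show "v $ i = w $ i" using i by simp
qed (use v w in auto)

lemma smult_vec_eq_zeroD:
  fixes v :: "'a :: idom Matrix.vec"
  assumes v: "v \<in> carrier_vec n" and eq: "c \<cdot>\<^sub>v v = 0\<^sub>v n"
  shows "c = 0 \<or> v = 0\<^sub>v n"
proof (rule disjCI)
  assume nz: "v \<noteq> 0\<^sub>v n"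
  then obtain i where i: "i < n" "v $ i \<noteq> 0" using v by (metis carrier_vecD eq_vecI index_zero_vec)
  have "(c \<cdot>\<^sub>v v) $ i = 0" using i unfolding eq by simp
  then show "c = 0" using i v by simp
qed

text \<open>Over the complex numbers a Jordan form exists. The hypothesis \<open>gen\<close> says
  that a vector killed by the square of \<open>A - c\<close> is already killed by
  \<open>A - c\<close>, and a Jordan block of size two or more would violate this.\<close>

lemma diagonalizable_if_eigenspaces_maximal:
  fixes A :: "complex mat"
  assumes A: "A \<in> carrier_mat n n"
    and gen: "\<And>x c. x \<in> carrier_vec n \<Longrightarrow>
      A *\<^sub>v (A *\<^sub>v x - c \<cdot>\<^sub>v x) = c \<cdot>\<^sub>v (A *\<^sub>v x - c \<cdot>\<^sub>v x) \<Longrightarrow> A *\<^sub>v x - c \<cdot>\<^sub>v x = 0\<^sub>v n"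
  shows "diagonalizable A"
proof -
  obtain n_as where jnf: "jordan_nf A n_as"
    using char_poly_factorized[OF A] jordan_nf_exists[OF A] by blast
  have ker: "mat_kernel (char_matrix A c ^\<^sub>m 2) = mat_kernel (char_matrix A c ^\<^sub>m 1)" for c
  proof -
    let ?C = "char_matrix A c"
    have C: "?C \<in> carrier_mat n n" using A by auto
    have Cx: "?C *\<^sub>v x = A *\<^sub>v x - c \<cdot>\<^sub>v x" if x: "x \<in> carrier_vec n" for x
      unfolding char_matrix_def
      by (rule eq_vecI, insert x A, auto simp: add_scalar_prod_distrib[of _ n])
    have C2: "?C ^\<^sub>m 2 = ?C * ?C" using C by (simp add: numeral_2_eq_2)
    have "?C *\<^sub>v x = 0\<^sub>v n" if x: "x \<in> carrier_vec n" and z: "?C *\<^sub>v (?C *\<^sub>v x) = 0\<^sub>v n" for x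
    proof -
      let ?y = "A *\<^sub>v x - c \<cdot>\<^sub>v x"
      have y: "?y \<in> carrier_vec n" using A x by auto
      have eq: "A *\<^sub>v ?y - c \<cdot>\<^sub>v ?y = 0\<^sub>v n" using z Cx[OF x] Cx[OF y] by simp
      have "A *\<^sub>v ?y = c \<cdot>\<^sub>v ?y"
        by (rule minus_vec_eq_zeroD[OF _ _ eq]) (use A y in auto)
      then show ?thesis using gen[OF x] Cx[OF x] by simp
    qed
    then show ?thesis
      unfolding mat_kernel_def C2 using C assoc_mult_mat_vec[OF C C] by auto
  qed
  have "dim_gen_eigenspace A c 2 = dim_gen_eigenspace A c 1" for c
    unfolding dim_gen_eigenspace_def kernel_dim_def ker using A by simp
  \<comment> \<open>The kernel of the \<open>k\<close>-th power of \<open>A - c\<close> has as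
    dimension the sum of \<open>min k m\<close> over the sizes \<open>m\<close> of the Jordan blocks
    for \<open>c\<close>. Equal kernels for \<open>k = 2\<close> and \<open>k = 1\<close> therefore
    equate the two sums.\<close>
  then have sums: "(\<Sum>m \<leftarrow> map fst [(m, e)\<leftarrow>n_as. e = c]. min 2 m) = (\<Sum>m \<leftarrow> map fst [(m, e)\<leftarrow>n_as. e = c]. min 1 m)" for c
    using dim_gen_eigenspace[OF jnf] by metis
  have one: "m = 1" if "(m, c) \<in> set n_as" for m c
  proof -
    have m0: "m \<noteq> 0" using jnf that unfolding jordan_nf_def by force
    \<comment> \<open>The summands are ordered termwise, and a size above one makes its summand
      strictly larger. Equality of the sums thus leaves only blocks of size one.\<close>
    have "(\<Sum>a \<leftarrow> l. min 2 a) > (\<Sum>a \<leftarrow> l. min 1 a)" if "m \<in> set l" "m > 1" for l :: "nat list"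
      using that
    proof (induction l)
      case (Cons a l)
      have le: "(\<Sum>a \<leftarrow> l. min 1 a) \<le> (\<Sum>a \<leftarrow> l. min 2 a)" by (rule sum_list_mono) auto
      show ?case
      proof (cases "m \<in> set l")
        case True then show ?thesis using Cons by simp
      next
        case False
        then have "m = a" using Cons by auto
        then show ?thesis using le Cons by simp
      qed
    qed simp
    moreover have "m \<in> set (map fst [(m, e)\<leftarrow>n_as. e = c])" using that by force
    ultimately have "\<not> m > 1" using sums[of c] by fastforce
    then show ?thesis using m0 by simp
  qed
  have "diagonal_mat (jordan_matrix n_as)" using one
  proof (induction n_as)
    case Nil then show ?case by (simp add: jordan_matrix_def diagonal_mat_def)
  next
    case (Cons p n_as)
    obtain m e where p: "p = (m, e)" by force
    have m: "m = 1" using Cons p by auto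
    have IH: "diagonal_mat (jordan_matrix n_as)" using Cons by auto
    have "jordan_matrix (p # n_as) = four_block_mat (jordan_block 1 e) (0\<^sub>m 1 (dim_col (jordan_matrix n_as)))
        (0\<^sub>m (dim_row (jordan_matrix n_as)) 1) (jordan_matrix n_as)"
      unfolding jordan_matrix_def p m by (simp add: Let_def)
    then show ?case using IH unfolding diagonal_mat_def
      by (auto simp: Suc_diff_le)
  qed
  then show ?thesis using jnf unfolding diagonalizable_def jordan_nf_def by blast
qed

section \<open>Adjoints and the Hermitian form on complex vectors\<close>

lemma mat_adjoint_dims [simp]:
  "dim_row (mat_adjoint A) = dim_col A" "dim_col (mat_adjoint A) = dim_row A"
  by (simp_all add: mat_adjoint_def)

lemma mat_adjoint_carrier [simp, intro]: "A \<in> carrier_mat n m \<Longrightarrow> mat_adjoint A \<in> carrier_mat m n"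
  by auto

lemma mat_adjoint_index [simp]:
  "i < dim_col A \<Longrightarrow> j < dim_row A \<Longrightarrow> mat_adjoint A $$ (i, j) = conjugate (A $$ (j, i))"
  by (simp add: mat_adjoint_def mat_of_rows_index)

lemma mat_adjoint_adjoint [simp]: "mat_adjoint (mat_adjoint A) = A"
  by (rule eq_matI) auto

lemma cscalar_prod_adjoint:
  fixes A :: "complex mat"
  assumes A: "A \<in> carrier_mat n m" and v: "v \<in> carrier_vec m" and w: "w \<in> carrier_vec n"
  shows "(A *\<^sub>v v) \<bullet>c w = v \<bullet>c (mat_adjoint A *\<^sub>v w)"
proof -
  have "(A *\<^sub>v v) \<bullet>c w = (\<Sum>i<n. \<Sum>j<m. A $$ (i,j) * v $ j * cnj (w $ i))"
    using A v w by (auto simp: scalar_prod_def atLeast0LessThan sum_distrib_right intro!: sum.cong)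
  also have "\<dots> = (\<Sum>j<m. \<Sum>i<n. A $$ (i,j) * v $ j * cnj (w $ i))" by (rule sum.swap)
  also have "\<dots> = v \<bullet>c (mat_adjoint A *\<^sub>v w)"
    using A v w by (auto simp: scalar_prod_def atLeast0LessThan sum_distrib_left mult_ac intro!: sum.cong)
  finally show ?thesis .
qed

lemma cscalar_prod_commute:
  fixes v w :: "complex vec"
  assumes "v \<in> carrier_vec n" "w \<in> carrier_vec n"
  shows "v \<bullet>c w = cnj (w \<bullet>c v)"
  using assms by (auto simp: scalar_prod_def mult.commute intro!: sum.cong)

text \<open>The nonzero spectrum of \<open>X * Y\<close> is that of \<open>Y * X\<close>, a
  Hermitian involution times a positive definite matrix. Since \<open>Y * X\<close> is injective,
  the eigenvalue 0 that \<open>X * Y\<close> may acquire has no Jordan block of size above one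
  either. Writing the positive factor through \<open>Z\<close> lets its lower bound by the identity
  be read off from a squared norm.\<close>

lemma semisimple_product:
  fixes X Y J Z :: "complex mat"
  assumes X: "X \<in> carrier_mat n m" and Y: "Y \<in> carrier_mat m n"
    and J: "J \<in> carrier_mat m m" and Z: "Z \<in> carrier_mat m l"
    and Jherm: "mat_adjoint J = J" and Jinv: "J * J = 1\<^sub>m m"
    and YX: "Y * X = J * (1\<^sub>m m + Z * mat_adjoint Z)"
  shows "diagonalizable (X * Y)"
    and "eigenvalue (X * Y) c \<Longrightarrow> c \<in> \<real> \<and> (c = 0 \<or> 1 \<le> cmod c)"
proof -
  define P where "P = 1\<^sub>m m + Z * mat_adjoint Z"
  define A where "A = Y * X"
  have P: "P \<in> carrier_mat m m" using Z by (auto simp: P_def)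
  have A: "A \<in> carrier_mat m m" using X Y by (auto simp: A_def)
  have AJP: "A = J * P" unfolding A_def P_def by (rule YX)
  have Av: "A *\<^sub>v w = J *\<^sub>v (P *\<^sub>v w)" if "w \<in> carrier_vec m" for w
    unfolding AJP using J P that by auto
  have YXv: "Y *\<^sub>v (X *\<^sub>v w) = A *\<^sub>v w" if "w \<in> carrier_vec m" for w
    unfolding A_def using X Y that by auto
  have XYv: "(X * Y) *\<^sub>v w = X *\<^sub>v (Y *\<^sub>v w)" if "w \<in> carrier_vec n" for w
    using X Y that by auto
  have X0: "X *\<^sub>v 0\<^sub>v m = 0\<^sub>v n"
    using X by (intro eq_vecI) auto
  have JJv: "J *\<^sub>v (J *\<^sub>v w) = w" if "w \<in> carrier_vec m" for w
    using assoc_mult_mat_vec[OF J J that] Jinv that by simp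
  have Pv: "P *\<^sub>v w = w + Z *\<^sub>v (mat_adjoint Z *\<^sub>v w)" if w: "w \<in> carrier_vec m" for w
    unfolding P_def using Z w by (subst add_mult_distrib_mat_vec[of _ m m]) (auto simp: assoc_mult_mat_vec[of _ m l _ m])
  have Jh: "(J *\<^sub>v v) \<bullet>c w = v \<bullet>c (J *\<^sub>v w)" if "v \<in> carrier_vec m" "w \<in> carrier_vec m" for v w
    using cscalar_prod_adjoint[OF J that] Jherm by simp
  have Zv: "mat_adjoint Z *\<^sub>v v \<in> carrier_vec l" if "v \<in> carrier_vec m" for v
    using mult_mat_vec_carrier[OF mat_adjoint_carrier[OF Z] that] .
  have P_form: "(P *\<^sub>v v) \<bullet>c w = v \<bullet>c w + (mat_adjoint Z *\<^sub>v v) \<bullet>c (mat_adjoint Z *\<^sub>v w)"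
    if v: "v \<in> carrier_vec m" and w: "w \<in> carrier_vec m" for v w
  proof -
    have "(P *\<^sub>v v) \<bullet>c w = v \<bullet>c w + (Z *\<^sub>v (mat_adjoint Z *\<^sub>v v)) \<bullet>c w"
      unfolding Pv[OF v] using v w mult_mat_vec_carrier[OF Z Zv[OF v]]
      by (simp add: add_scalar_prod_distrib[of _ m])
    then show ?thesis using cscalar_prod_adjoint[OF Z Zv[OF v] w] by simp
  qed
  have P_form': "v \<bullet>c (P *\<^sub>v w) = v \<bullet>c w + (mat_adjoint Z *\<^sub>v v) \<bullet>c (mat_adjoint Z *\<^sub>v w)"
    if v: "v \<in> carrier_vec m" and w: "w \<in> carrier_vec m" for v w
  proof -
    have "v \<bullet>c (P *\<^sub>v w) = cnj ((P *\<^sub>v w) \<bullet>c v)"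
      by (rule cscalar_prod_commute[of _ m]) (use v w P in auto)
    also have "\<dots> = cnj (w \<bullet>c v) + cnj ((mat_adjoint Z *\<^sub>v w) \<bullet>c (mat_adjoint Z *\<^sub>v v))"
      unfolding P_form[OF w v] by simp
    also have "cnj (w \<bullet>c v) = v \<bullet>c w" using cscalar_prod_commute[OF v w] by simp
    also have "cnj ((mat_adjoint Z *\<^sub>v w) \<bullet>c (mat_adjoint Z *\<^sub>v v)) = (mat_adjoint Z *\<^sub>v v) \<bullet>c (mat_adjoint Z *\<^sub>v w)"
      by (rule cscalar_prod_commute[OF Zv[OF v] Zv[OF w], symmetric])
    finally show ?thesis .
  qed
  have Ph: "(P *\<^sub>v v) \<bullet>c w = v \<bullet>c (P *\<^sub>v w)" if "v \<in> carrier_vec m" "w \<in> carrier_vec m" for v w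
    using P_form[OF that] P_form'[OF that] by simp
  have norm_real: "v \<bullet>c v = complex_of_real (Re (v \<bullet>c v))" "0 \<le> Re (v \<bullet>c v)" for v :: "complex vec"
    using conjugate_square_ge_0_vec[of v] by (auto simp: less_eq_complex_def complex_eq_iff)
  have norm_zero: "v = 0\<^sub>v k" if "v \<in> carrier_vec k" "Re (v \<bullet>c v) = 0" for v :: "complex vec" and k
    using that norm_real(1)[of v] conjugate_square_eq_0_vec[OF that(1)] by simp
  \<comment> \<open>With both arguments equal, the second summand in \<open>P_form\<close> is a
    squared norm; hence the form of \<open>P\<close> is real and dominates the standard one.\<close>
  have q: "(P *\<^sub>v w) \<bullet>c w = complex_of_real (Re ((P *\<^sub>v w) \<bullet>c w))"
      "Re (w \<bullet>c w) \<le> Re ((P *\<^sub>v w) \<bullet>c w)" if w: "w \<in> carrier_vec m" for w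
  proof -
    let ?z = "mat_adjoint Z *\<^sub>v w"
    have "(P *\<^sub>v w) \<bullet>c w = complex_of_real (Re (w \<bullet>c w) + Re (?z \<bullet>c ?z))"
      unfolding P_form[OF w w] of_real_add using norm_real(1)[of w] norm_real(1)[of ?z] by simp
    then show "(P *\<^sub>v w) \<bullet>c w = complex_of_real (Re ((P *\<^sub>v w) \<bullet>c w))"
      "Re (w \<bullet>c w) \<le> Re ((P *\<^sub>v w) \<bullet>c w)" using norm_real(2)[of ?z] by simp_all
  qed
  have P_inj: "w = 0\<^sub>v m" if w: "w \<in> carrier_vec m" and 0: "P *\<^sub>v w = 0\<^sub>v m" for w
  proof (rule norm_zero[OF w])
    have "(P *\<^sub>v w) \<bullet>c w = 0" unfolding 0 using w by simp
    then show "Re (w \<bullet>c w) = 0" using q(2)[OF w] norm_real(2)[of w] by simp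
  qed
  have A_inj: "w = 0\<^sub>v m" if w: "w \<in> carrier_vec m" and 0: "A *\<^sub>v w = 0\<^sub>v m" for w
  proof (rule P_inj[OF w])
    have "P *\<^sub>v w = J *\<^sub>v (A *\<^sub>v w)" unfolding Av[OF w] using JJv P w by simp
    then show "P *\<^sub>v w = 0\<^sub>v m" unfolding 0 using J by auto
  qed
  \<comment> \<open>Applying \<open>J\<close> to \<open>J P w = c w\<close> and pairing with
    \<open>w\<close> gives \<open>p = c j\<close>. Here \<open>j\<close> is real because
    \<open>J\<close> is Hermitian, and nonzero because \<open>p > 0\<close>; so
    \<open>c = p / j\<close>.\<close>
  have A_ev: "c \<in> \<real> \<and> 1 \<le> cmod c"
    if w: "w \<in> carrier_vec m" and w0: "w \<noteq> 0\<^sub>v m" and ev: "A *\<^sub>v w = c \<cdot>\<^sub>v w" for w c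
  proof -
    define p where "p = Re ((P *\<^sub>v w) \<bullet>c w)"
    define r where "r = Re (w \<bullet>c w)"
    define j where "j = (J *\<^sub>v w) \<bullet>c w"
    have Pw: "P *\<^sub>v w \<in> carrier_vec m" and Jw: "J *\<^sub>v w \<in> carrier_vec m" using P J w by auto
    have r0: "r > 0" using norm_zero[OF w] norm_real(2)[of w] w0 unfolding r_def by force
    have rp: "r \<le> p" unfolding r_def p_def by (rule q(2)[OF w])
    have peq: "(P *\<^sub>v w) \<bullet>c w = of_real p" unfolding p_def by (rule q(1)[OF w])
    have PJ: "P *\<^sub>v w = c \<cdot>\<^sub>v (J *\<^sub>v w)"
    proof -
      have "P *\<^sub>v w = J *\<^sub>v (A *\<^sub>v w)" unfolding Av[OF w] using JJv Pw by simp
      then show ?thesis unfolding ev using J w by auto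
    qed
    have pj: "of_real p = c * j"
      unfolding peq[symmetric] j_def by (subst PJ) (use w Jw in simp)
    have jr: "cnj j = j"
      unfolding j_def using cscalar_prod_commute[OF w Jw] Jh[OF w w] by simp
    then have jreal: "j = of_real (Re j)" by (simp add: complex_eq_iff)
    have j0: "Re j \<noteq> 0"
    proof
      assume "Re j = 0"
      then have "p = 0" using pj jreal by simp
      then show False using r0 rp by simp
    qed
    have c: "c = of_real (p / Re j)" using pj jreal j0
      by (metis nonzero_mult_div_cancel_right of_real_divide of_real_eq_0_iff)
    have JwJw: "(J *\<^sub>v w) \<bullet>c (J *\<^sub>v w) = w \<bullet>c w"
      using Jh[OF w Jw] JJv[OF w] by simp
    have wJw: "w \<bullet>c (J *\<^sub>v w) = j" unfolding j_def using Jh[OF w w] by simp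
    \<comment> \<open>Expanding the squared norms of \<open>w + J w\<close> and
      \<open>w - J w\<close> takes the place of Cauchy-Schwarz: \<open>J\<close> preserves norms, so
      their nonnegativity bounds the modulus of \<open>j\<close> by \<open>r\<close>, hence by
      \<open>p\<close>.\<close>
    have "(w + J *\<^sub>v w) \<bullet>c (w + J *\<^sub>v w) = 2 * (w \<bullet>c w) + 2 * j"
      using w Jw JwJw wJw
      by (simp add: conjugate_add_vec[of _ m] add_scalar_prod_distrib[of _ m] scalar_prod_add_distrib[of _ m] j_def)
    then have "0 \<le> r + Re j" using norm_real(2)[of "w + J *\<^sub>v w"] by (simp add: r_def)
    moreover have "(w - J *\<^sub>v w) \<bullet>c (w - J *\<^sub>v w) = 2 * (w \<bullet>c w) - 2 * j"
    proof -
      have "conjugate (w - J *\<^sub>v w) = conjugate w - conjugate (J *\<^sub>v w)"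
        using J w Jw by (intro eq_vecI) auto
      then show ?thesis using w Jw JwJw wJw
        by (simp add: minus_scalar_prod_distrib[of _ m] scalar_prod_minus_distrib[of _ m] j_def)
    qed
    then have "0 \<le> r - Re j" using norm_real(2)[of "w - J *\<^sub>v w"] by (simp add: r_def)
    ultimately have "\<bar>Re j\<bar> \<le> p" using rp by linarith
    then have "1 \<le> p / \<bar>Re j\<bar>" using j0 by simp
    moreover have "cmod c = p / \<bar>Re j\<bar>"
      unfolding c norm_of_real abs_divide using r0 rp by simp
    ultimately show ?thesis using c by simp
  qed
  \<comment> \<open>For nonzero \<open>c\<close>, \<open>Y\<close> sends an eigenvector of
    \<open>X * Y\<close> to an eigenvector of \<open>A\<close>; the image is nonzero, since
    \<open>Y x = 0\<close> would force \<open>c x = 0\<close>.\<close>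
  have ev_real: "c \<in> \<real> \<and> (c = 0 \<or> 1 \<le> cmod c)"
    if x: "x \<in> carrier_vec n" and x0: "x \<noteq> 0\<^sub>v n" and ev: "(X * Y) *\<^sub>v x = c \<cdot>\<^sub>v x" for x c
  proof (cases "c = 0")
    case False
    have Yx: "Y *\<^sub>v x \<in> carrier_vec m" using Y x by auto
    have ev': "X *\<^sub>v (Y *\<^sub>v x) = c \<cdot>\<^sub>v x" using ev XYv[OF x] by simp
    have "Y *\<^sub>v x \<noteq> 0\<^sub>v m"
    proof
      assume "Y *\<^sub>v x = 0\<^sub>v m"
      then have "c \<cdot>\<^sub>v x = 0\<^sub>v n" using ev' X0 by simp
      then show False using x0 x False by (auto dest: smult_vec_eq_zeroD[OF x])
    qed
    moreover have "A *\<^sub>v (Y *\<^sub>v x) = c \<cdot>\<^sub>v (Y *\<^sub>v x)"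
      using YXv[OF Yx] ev' mult_mat_vec[OF Y x] by simp
    ultimately show ?thesis using A_ev[OF Yx] by blast
  qed simp
  show "c \<in> \<real> \<and> (c = 0 \<or> 1 \<le> cmod c)" if "eigenvalue (X * Y) c"
    using that X ev_real unfolding eigenvalue_def eigenvector_def by auto
  show "diagonalizable (X * Y)"
  proof (rule diagonalizable_if_eigenspaces_maximal)
    show "X * Y \<in> carrier_mat n n" using X Y by auto
    fix x :: "complex Matrix.vec" and c
    assume x: "x \<in> carrier_vec n"
    \<comment> \<open>If \<open>y\<close> were nonzero, \<open>x\<close> and \<open>y\<close> would
      form a Jordan chain of length two for \<open>X * Y\<close>. Applying \<open>Y\<close> carries
      the chain over to \<open>A\<close>, as \<open>w\<close> and \<open>z\<close>.\<close>
    define y where "y = (X * Y) *\<^sub>v x - c \<cdot>\<^sub>v x"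
    assume "X * Y *\<^sub>v (X * Y *\<^sub>v x - c \<cdot>\<^sub>v x) = c \<cdot>\<^sub>v (X * Y *\<^sub>v x - c \<cdot>\<^sub>v x)"
    then have ey: "X * Y *\<^sub>v y = c \<cdot>\<^sub>v y" unfolding y_def .
    have y: "y \<in> carrier_vec n" using X Y x by (auto simp: y_def)
    define w where "w = Y *\<^sub>v x"
    have w: "w \<in> carrier_vec m" using Y x by (auto simp: w_def)
    have Aw: "A *\<^sub>v w \<in> carrier_vec m" using A w by auto
    define z where "z = A *\<^sub>v w - c \<cdot>\<^sub>v w"
    have z: "z \<in> carrier_vec m" using A w by (auto simp: z_def)
    have Yy: "Y *\<^sub>v y = z"
    proof -
      have "Y *\<^sub>v y = Y *\<^sub>v (X *\<^sub>v w) - c \<cdot>\<^sub>v (Y *\<^sub>v x)"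
        unfolding y_def XYv[OF x] w_def[symmetric]
        using X Y x w by (simp add: mult_minus_distrib_mat_vec[of _ m n] mult_mat_vec[OF Y x] w_def[symmetric])
      then show ?thesis using YXv[OF w] by (simp add: z_def w_def)
    qed
    have Az: "A *\<^sub>v z = c \<cdot>\<^sub>v z"
      using arg_cong[OF ey, of "\<lambda>t. Y *\<^sub>v t"] YXv[OF z] mult_mat_vec[OF Y y] unfolding XYv[OF y] Yy by simp
    have "y = 0\<^sub>v n" 
    proof (cases "c = 0")
      case True
      \<comment> \<open>Injectivity of \<open>A\<close> is used twice: \<open>A z = 0\<close> gives
        \<open>z = A w = 0\<close>, then \<open>w = 0\<close>; and for \<open>c = 0\<close> the
        vector \<open>y\<close> is \<open>X w\<close>.\<close>
      have "A *\<^sub>v z = 0\<^sub>v m" unfolding Az True using z by auto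
      then have "z = 0\<^sub>v m" by (rule A_inj[OF z])
      then have "A *\<^sub>v w - 0 \<cdot>\<^sub>v w = 0\<^sub>v m" unfolding z_def True .
      moreover have "0 \<cdot>\<^sub>v w = 0\<^sub>v m" using w by auto
      ultimately have "A *\<^sub>v w = 0\<^sub>v m" using minus_vec_eq_zeroD[OF Aw zero_carrier_vec] by simp
      then have "w = 0\<^sub>v m" by (rule A_inj[OF w])
      then show ?thesis unfolding y_def XYv[OF x] w_def[symmetric] True using X0 x by auto
    next
      case False
      have "z = 0\<^sub>v m"
      proof (rule ccontr)
        assume z0: "z \<noteq> 0\<^sub>v m"
        then have cr: "cnj c = c" using A_ev[OF z z0 Az] by (auto simp: Reals_cnj_iff)
        have Pz: "P *\<^sub>v z \<in> carrier_vec m" using P z by auto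
        \<comment> \<open>\<open>A\<close> is self-adjoint for the form of \<open>P\<close>. With
          \<open>c\<close> real, \<open>z = (A - c) w\<close> is then orthogonal to itself in that
          form, because \<open>A - c\<close> moved to the other side annihilates
          \<open>z\<close>.\<close>
        have "(A *\<^sub>v w) \<bullet>c (P *\<^sub>v z) = w \<bullet>c (P *\<^sub>v (A *\<^sub>v z))"
          unfolding Av[OF w] Av[OF z]
          using Jh[of "P *\<^sub>v w" "P *\<^sub>v z"] Ph[of w "J *\<^sub>v (P *\<^sub>v z)"] P J w z by auto
        also have "\<dots> = c * (w \<bullet>c (P *\<^sub>v z))"
          unfolding Az mult_mat_vec[OF P z] using w Pz cr by (simp add: conjugate_smult_vec)
        finally have "z \<bullet>c (P *\<^sub>v z) = 0"
          unfolding z_def[symmetric] using Aw w Pz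
          by (subst (1) z_def) (simp add: minus_scalar_prod_distrib[of _ m])
        then have "(P *\<^sub>v z) \<bullet>c z = 0" using Ph[OF z z] by simp
        then have "Re (z \<bullet>c z) = 0" using q(2)[OF z] norm_real(2)[of z] by simp
        then show False using norm_zero[OF z] z0 by simp
      qed
      then have "c \<cdot>\<^sub>v y = 0\<^sub>v n" using ey XYv[OF y] Yy X0 by simp
      then show ?thesis using False by (auto dest: smult_vec_eq_zeroD[OF y])
    qed
    then show "X * Y *\<^sub>v x - c \<cdot>\<^sub>v x = 0\<^sub>v n" unfolding y_def .
  qed
qed

subsection \<open>Block form of the BdG matrix\<close>

lemma mat_adjoint_mult:
  fixes A B :: "complex mat"
  assumes "A \<in> carrier_mat n m" "B \<in> carrier_mat m l"
  shows "mat_adjoint (A * B) = mat_adjoint B * mat_adjoint A"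
  using assms by (intro eq_matI) (auto simp: scalar_prod_def mult.commute intro!: sum.cong)

lemma mat_adjoint_add:
  fixes A B :: "complex mat"
  assumes "A \<in> carrier_mat n m" "B \<in> carrier_mat n m"
  shows "mat_adjoint (A + B) = mat_adjoint A + mat_adjoint B"
  using assms by (intro eq_matI) auto

lemma mat_adjoint_minus:
  fixes A B :: "complex mat"
  assumes "A \<in> carrier_mat n m" "B \<in> carrier_mat n m"
  shows "mat_adjoint (A - B) = mat_adjoint A - mat_adjoint B"
  using assms by (intro eq_matI) auto

lemma mat_adjoint_smult:
  fixes A :: "complex mat"
  shows "mat_adjoint (c \<cdot>\<^sub>m A) = cnj c \<cdot>\<^sub>m mat_adjoint A"
  by (intro eq_matI) auto

lemma mat_adjoint_four_block:
  fixes A :: "complex mat"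
  assumes "A \<in> carrier_mat n1 m1" "B \<in> carrier_mat n1 m2" "C \<in> carrier_mat n2 m1" "D \<in> carrier_mat n2 m2"
  shows "mat_adjoint (four_block_mat A B C D) =
    four_block_mat (mat_adjoint A) (mat_adjoint C) (mat_adjoint B) (mat_adjoint D)"
  using assms by (intro eq_matI) auto

lemma mat_adjoint_transpose:
  fixes A :: "complex mat"
  shows "mat_adjoint (transpose_mat A) = transpose_mat (mat_adjoint A)"
  by (intro eq_matI) auto

lemma tau_x_conj:
  fixes A :: "complex mat"
  assumes c: "A \<in> carrier_mat N N" "B \<in> carrier_mat N N" "C \<in> carrier_mat N N" "D \<in> carrier_mat N N"
  shows "tau_x N * four_block_mat A B C D * tau_x N = four_block_mat D C B A"
proof -
  have "tau_x N * four_block_mat A B C D = four_block_mat C D A B"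
    unfolding tau_x_def by (subst mult_four_block_mat[OF _ _ _ _ c]) (use c in auto)
  moreover have "four_block_mat C D A B * tau_x N = four_block_mat D C B A"
    unfolding tau_x_def by (subst mult_four_block_mat[OF c(3,4,1,2)]) (use c in auto)
  ultimately show ?thesis by simp
qed

text \<open>The BdG matrix depends on \<open>u\<close> and \<open>v\<close> only through such
  combinations, which carry the signs of the two species. Smoothness and periodicity are inherited
  from the gauge-invariant products inside.\<close>

definition signed_gram :: "(bool \<Rightarrow> 'd \<Rightarrow> complex mat) \<Rightarrow> (bool \<Rightarrow> 'd \<Rightarrow> complex mat) \<Rightarrow> 'd \<Rightarrow> complex mat" where
  "signed_gram a b k = mat_adjoint (a True k) * b True k - mat_adjoint (a False k) * b False k"

lemma signed_gram_carrier:
  assumes "\<And>\<sigma> k. a \<sigma> k \<in> carrier_mat (R \<sigma>) N" "\<And>\<sigma> k. b \<sigma> k \<in> carrier_mat (R \<sigma>) N"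
  shows "signed_gram a b k \<in> carrier_mat N N"
  unfolding signed_gram_def
  by (intro minus_carrier_mat mult_carrier_mat[of _ _ "R False"] mat_adjoint_carrier assms)

lemma signed_gram_adjoint:
  assumes a: "\<And>\<sigma> k. a \<sigma> k \<in> carrier_mat (R \<sigma>) N" and b: "\<And>\<sigma> k. b \<sigma> k \<in> carrier_mat (R \<sigma>) N"
  shows "mat_adjoint (signed_gram a b k) = signed_gram b a k"
  unfolding signed_gram_def
    mat_adjoint_minus[OF mult_carrier_mat[OF mat_adjoint_carrier[OF a[of True k]] b[of True k]]
      mult_carrier_mat[OF mat_adjoint_carrier[OF a[of False k]] b[of False k]]]
    mat_adjoint_mult[OF mat_adjoint_carrier[OF a] b] by simp

lemma signed_gram_smult:
  assumes a: "\<And>\<sigma> k. a \<sigma> k \<in> carrier_mat (R \<sigma>) N" and b: "\<And>\<sigma> k. b \<sigma> k \<in> carrier_mat (R \<sigma>) N"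
  shows "signed_gram a (\<lambda>\<sigma> k. c \<cdot>\<^sub>m b \<sigma> k) k = c \<cdot>\<^sub>m signed_gram a b k"
    and "signed_gram (\<lambda>\<sigma> k. c \<cdot>\<^sub>m a \<sigma> k) b k = cnj c \<cdot>\<^sub>m signed_gram a b k"
proof -
  note ab = mult_carrier_mat[OF mat_adjoint_carrier[OF a] b]
  have dist: "c \<cdot>\<^sub>m (A - B) = c \<cdot>\<^sub>m A - c \<cdot>\<^sub>m B" if "A \<in> carrier_mat N N" "B \<in> carrier_mat N N" for c and A B :: "complex mat"
    using that by (intro eq_matI) (auto simp: algebra_simps)
  show "signed_gram a (\<lambda>\<sigma> k. c \<cdot>\<^sub>m b \<sigma> k) k = c \<cdot>\<^sub>m signed_gram a b k"
    unfolding signed_gram_def mult_smult_distrib[OF mat_adjoint_carrier[OF a] b] dist[OF ab ab] ..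
  show "signed_gram (\<lambda>\<sigma> k. c \<cdot>\<^sub>m a \<sigma> k) b k = cnj c \<cdot>\<^sub>m signed_gram a b k"
    unfolding signed_gram_def mat_adjoint_smult mult_smult_assoc_mat[OF mat_adjoint_carrier[OF a] b] dist[OF ab ab] ..
qed

text \<open>\<open>Wmat\<close> places two blocks side by side by adding blocks without rows.
  Products over these are empty sums, so only the genuine rows contribute.\<close>

lemma Wmat_gram:
  fixes A :: "complex mat"
  assumes A: "A \<in> carrier_mat r N" and B: "B \<in> carrier_mat r N"
  shows "mat_adjoint (Wmat N A B) * Wmat N A B =
    four_block_mat (mat_adjoint A * A) (mat_adjoint A * B) (mat_adjoint B * A) (mat_adjoint B * B)"
proof -
  have z: "(0\<^sub>m 0 N :: complex mat) \<in> carrier_mat 0 N" by simp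
  have z0: "mat_adjoint (0\<^sub>m 0 N :: complex mat) * 0\<^sub>m 0 N = 0\<^sub>m N N" by (intro eq_matI) (auto simp: scalar_prod_def)
  show ?thesis
    unfolding Wmat_def mat_adjoint_four_block[OF A B z z]
    by (subst mult_four_block_mat[OF _ _ _ _ A B z z]) (use A B z0 in auto)
qed

lemma Mmat_blocks:
  assumes a: "\<And>\<sigma> k. a \<sigma> k \<in> carrier_mat (R \<sigma>) N" and b: "\<And>\<sigma> k. b \<sigma> k \<in> carrier_mat (R \<sigma>) N"
  shows "Mmat N a b k = four_block_mat (signed_gram a a k) (signed_gram a b k) (signed_gram b a k) (signed_gram b b k)"
  unfolding Mmat_def Wmat_gram[OF a b] signed_gram_def
  using a[of True k] a[of False k] b[of True k] b[of False k] by (intro eq_matI) auto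

text \<open>Transposition exchanges the off-diagonal blocks and conjugation by \<open>tau_x\<close>
  exchanges them back. The mixed blocks thus keep their place while the two diagonal blocks trade
  theirs.\<close>

lemma bdg_H_blocks:
  assumes a: "\<And>\<sigma> k. a \<sigma> k \<in> carrier_mat (R \<sigma>) N" and b: "\<And>\<sigma> k. b \<sigma> k \<in> carrier_mat (R \<sigma>) N"
  shows "bdg_H N a b k = four_block_mat
      (signed_gram a a k + transpose_mat (signed_gram b b (-k)))
      (signed_gram a b k + transpose_mat (signed_gram a b (-k)))
      (signed_gram b a k + transpose_mat (signed_gram b a (-k)))
      (signed_gram b b k + transpose_mat (signed_gram a a (-k)))"
proof -
  note cs = signed_gram_carrier[of a R N a, OF a a] signed_gram_carrier[of a R N b, OF a b]
    signed_gram_carrier[of b R N a, OF b a] signed_gram_carrier[of b R N b, OF b b]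
  have "tau_x N * transpose_mat (Mmat N a b (-k)) * tau_x N =
     four_block_mat (transpose_mat (signed_gram b b (-k))) (transpose_mat (signed_gram a b (-k)))
       (transpose_mat (signed_gram b a (-k))) (transpose_mat (signed_gram a a (-k)))"
    unfolding Mmat_blocks[of a R N b, OF a b] transpose_four_block_mat[OF cs]
    by (rule tau_x_conj) (use cs in auto)
  then show ?thesis
    unfolding bdg_H_def Mmat_blocks[of a R N b, OF a b]
    by (simp only:) (rule add_four_block_mat[OF cs(1,2,3,4)[of k]], use cs in auto)
qed

text \<open>Hermiticity holds because taking the adjoint of \<open>signed_gram\<close> swaps its
  arguments. Particle-hole symmetry holds because \<open>bdg_H\<close> adds to \<open>Mmat\<close>
  its image under an involution. With \<open>a\<close> and \<open>b\<close> arbitrary, every point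
  of the path is covered.\<close>

lemma bdg_H_is_bdg:
  assumes a: "\<And>\<sigma> k. a \<sigma> k \<in> carrier_mat (R \<sigma>) N" and b: "\<And>\<sigma> k. b \<sigma> k \<in> carrier_mat (R \<sigma>) N"
  shows "is_bdg N (bdg_H N a b)"
proof -
  note cs = signed_gram_carrier[of a R N a, OF a a] signed_gram_carrier[of a R N b, OF a b]
    signed_gram_carrier[of b R N a, OF b a] signed_gram_carrier[of b R N b, OF b b]
  note ads = signed_gram_adjoint[of a R N a, OF a a] signed_gram_adjoint[of a R N b, OF a b]
    signed_gram_adjoint[of b R N a, OF b a] signed_gram_adjoint[of b R N b, OF b b]
  note tcs = cs[THEN transpose_carrier_mat[THEN iffD2]]
  have h: "bdg_H N a b k \<in> carrier_mat (2*N) (2*N)" for k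
    unfolding bdg_H_blocks[of a R N b, OF a b] mult_2 by (intro four_block_carrier_mat add_carrier_mat tcs)
  have "mat_adjoint (bdg_H N a b k) = bdg_H N a b k" for k
    unfolding bdg_H_blocks[of a R N b, OF a b]
    by (subst mat_adjoint_four_block[of _ N N _ N _ N]; (intro add_carrier_mat tcs)?)
      (simp add: mat_adjoint_add[of _ N N] mat_adjoint_transpose ads cs)
  moreover have "bdg_H N a b (-k) = tau_x N * transpose_mat (bdg_H N a b k) * tau_x N" for k
  proof -
    have "tau_x N * transpose_mat (bdg_H N a b k) * tau_x N = four_block_mat
      (transpose_mat (signed_gram b b k + transpose_mat (signed_gram a a (-k))))
      (transpose_mat (signed_gram a b k + transpose_mat (signed_gram a b (-k))))
      (transpose_mat (signed_gram b a k + transpose_mat (signed_gram b a (-k))))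
      (transpose_mat (signed_gram a a k + transpose_mat (signed_gram b b (-k))))"
      unfolding bdg_H_blocks[of a R N b, OF a b]
      by (subst transpose_four_block_mat[of _ N N _ N _ N]; (intro add_carrier_mat tcs)?)
        (rule tau_x_conj; intro transpose_carrier_mat[THEN iffD2] add_carrier_mat tcs)
    also have "\<dots> = bdg_H N a b (-k)"
      unfolding bdg_H_blocks[of a R N b, OF a b] 
      by (intro cong_four_block_mat) (simp_all add: transpose_add[of _ N N] comm_add_mat[of _ N N] cs)
    finally show ?thesis ..
  qed
  ultimately show ?thesis using h unfolding is_bdg_def by blast
qed

text \<open>The end of the path: scaling by zero removes all blocks except those of \<open>a\<close>
  with itself, and \<open>signed_gram a a\<close> is \<open>Qmat a\<close>.\<close>

lemma bdg_H_smult_zero: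
  assumes a: "\<And>\<sigma> k. a \<sigma> k \<in> carrier_mat (R \<sigma>) N" and b: "\<And>\<sigma> k. b \<sigma> k \<in> carrier_mat (R \<sigma>) N"
  shows "bdg_H N a (\<lambda>\<sigma> k. 0 \<cdot>\<^sub>m b \<sigma> k) = bdg_Htilde N a"
proof
  fix k
  note cs = signed_gram_carrier[of a R N a, OF a a] signed_gram_carrier[of a R N b, OF a b]
    signed_gram_carrier[of b R N a, OF b a] signed_gram_carrier[of b R N b, OF b b]
  let ?b0 = "\<lambda>\<sigma> k. 0 \<cdot>\<^sub>m b \<sigma> k"
  have b0: "?b0 \<sigma> k \<in> carrier_mat (R \<sigma>) N" for \<sigma> k using b by simp
  have z: "0 \<cdot>\<^sub>m A = 0\<^sub>m N N" if "A \<in> carrier_mat N N" for A :: "complex mat"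
    using that by (intro eq_matI) auto
  have Q: "Qmat a k = signed_gram a a k" for k by (simp add: Qmat_def signed_gram_def)
  show "bdg_H N a (\<lambda>\<sigma> k. 0 \<cdot>\<^sub>m b \<sigma> k) k = bdg_Htilde N a k"
    unfolding bdg_H_blocks[of a R N ?b0, OF a b0] bdg_Htilde_def Q
      signed_gram_smult(1)[of a R N b, OF a b] signed_gram_smult(2)[of b R N a, OF b a]
      signed_gram_smult(1)[of ?b0 R N b, OF b0 b] signed_gram_smult(2)[of b R N b, OF b b]
    using cs by (simp add: z)
qed

subsection \<open>Spectrum of the scaled dynamical matrix\<close>

lemma smult_smult_mat:
  fixes A :: "'a :: semigroup_mult mat"
  shows "a \<cdot>\<^sub>m (b \<cdot>\<^sub>m A) = (a * b) \<cdot>\<^sub>m A"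
  by (intro eq_matI) (auto simp: mult.assoc)

lemma tau_z_mult_four_block:
  assumes c: "A \<in> carrier_mat N n1" "B \<in> carrier_mat N n2" "C \<in> carrier_mat N n1" "D \<in> carrier_mat N n2"
  shows "tau_z N * four_block_mat A B C D = four_block_mat A B (-C) (-D)"
  unfolding tau_z_def by (subst mult_four_block_mat[OF _ _ _ _ c]) (use c in auto)

lemma tau_z_carrier [simp]: "tau_z N \<in> carrier_mat (N + N) (N + N)"
  by (auto simp: tau_z_def)

lemma mult_block_diag:
  fixes A B :: "'a :: comm_ring_1 mat"
  assumes c: "A \<in> carrier_mat n n" "B \<in> carrier_mat m m" "C \<in> carrier_mat n k" "D \<in> carrier_mat m l"
  shows "four_block_mat A (0\<^sub>m n m) (0\<^sub>m m n) B * four_block_mat C (0\<^sub>m n l) (0\<^sub>m m k) D =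
    four_block_mat (A * C) (0\<^sub>m n l) (0\<^sub>m m k) (B * D)"
  by (subst mult_four_block_mat[OF c(1) _ _ c(2,3) _ _ c(4)]) (use c in auto)

text \<open>This treats a single momentum. \<open>[U, V]\<close> holds the rows of both species,
  \<open>[Vc, Uc]\<close> their particle-hole conjugates, and \<open>S\<close> the signs of the
  species. \<open>UU\<close>, \<open>UcUc\<close> and \<open>UV\<close> are the commutation
  relations of the unscaled rows; they determine \<open>W * (tau_z N * mat_adjoint W)\<close> for
  the scaled ones, from which the factorization required by \<open>semisimple_product\<close>
  follows.\<close>

lemma bdg_gram_spectrum:
  fixes U V Uc Vc S :: "complex mat" and s :: real
  assumes U: "U \<in> carrier_mat r N" and V: "V \<in> carrier_mat r N"
    and Uc: "Uc \<in> carrier_mat r N" and Vc: "Vc \<in> carrier_mat r N"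
    and S: "S \<in> carrier_mat r r" and Sherm: "mat_adjoint S = S" and Sinv: "S * S = 1\<^sub>m r"
    and s: "0 \<le> s" "s \<le> 1"
    and UU: "U * mat_adjoint U - V * mat_adjoint V = 1\<^sub>m r"
    and UcUc: "Uc * mat_adjoint Uc - Vc * mat_adjoint Vc = 1\<^sub>m r"
    and UV: "U * mat_adjoint Vc = V * mat_adjoint Uc"
    and h: "h = four_block_mat
      (mat_adjoint U * (S * U) + (of_real s)\<^sup>2 \<cdot>\<^sub>m (mat_adjoint Vc * (S * Vc)))
      (of_real s \<cdot>\<^sub>m (mat_adjoint U * (S * V) + mat_adjoint Vc * (S * Uc)))
      (of_real s \<cdot>\<^sub>m (mat_adjoint V * (S * U) + mat_adjoint Uc * (S * Vc)))
      ((of_real s)\<^sup>2 \<cdot>\<^sub>m (mat_adjoint V * (S * V)) + mat_adjoint Uc * (S * Uc))"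
  shows "diagonalizable (tau_z N * h)"
    and "eigenvalue (tau_z N * h) c \<Longrightarrow> c \<in> \<real> \<and> (c = 0 \<or> 1 \<le> cmod c)"
proof -
  let ?s = "complex_of_real s"
  \<comment> \<open>A real root of \<open>1 - s\<^sup>2\<close>, chosen so that \<open>Z\<close>
    times its adjoint is the excess of the positive factor over the identity.\<close>
  define t where "t = complex_of_real (sqrt (1 - s\<^sup>2))"
  have t2: "t * t = 1 - ?s\<^sup>2" "cnj t = t"
  proof -
    have "1 - s\<^sup>2 \<ge> 0" using s by (simp add: power_le_one)
    then show "t * t = 1 - ?s\<^sup>2" unfolding t_def of_real_mult[symmetric] by simp
  qed (simp add: t_def)
  define W where "W = four_block_mat U (?s \<cdot>\<^sub>m V) (?s \<cdot>\<^sub>m Vc) Uc"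
  define Sd where "Sd = four_block_mat S (0\<^sub>m r r) (0\<^sub>m r r) S"
  \<comment> \<open>The lower block has the opposite sign to that of \<open>Sd\<close>, because the
    particle-hole conjugate rows have negative norm with respect to \<open>tau_z\<close>.\<close>
  define J where "J = four_block_mat S (0\<^sub>m r r) (0\<^sub>m r r) (- S)"
  define Z where "Z = four_block_mat (t \<cdot>\<^sub>m V) (0\<^sub>m r N) (0\<^sub>m r N) (t \<cdot>\<^sub>m Vc)"
  let ?Ua = "mat_adjoint U" and ?Va = "mat_adjoint V" and ?Uca = "mat_adjoint Uc" and ?Vca = "mat_adjoint Vc"
  note c = U V Uc Vc S
  have Wa: "mat_adjoint W = four_block_mat ?Ua (?s \<cdot>\<^sub>m ?Vca) (?s \<cdot>\<^sub>m ?Va) ?Uca"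
    unfolding W_def by (subst mat_adjoint_four_block[of _ r N _ N _ r]) (use c in \<open>auto simp: mat_adjoint_smult\<close>)
  have W: "W \<in> carrier_mat (r + r) (N + N)" and Sd: "Sd \<in> carrier_mat (r + r) (r + r)"
    and J: "J \<in> carrier_mat (r + r) (r + r)" and Z: "Z \<in> carrier_mat (r + r) (N + N)"
    unfolding W_def Sd_def J_def Z_def using c by auto
  have W': "mat_adjoint W \<in> carrier_mat (N + N) (r + r)" using W by auto
  have SdW: "Sd * W = four_block_mat (S * U) (?s \<cdot>\<^sub>m (S * V)) (?s \<cdot>\<^sub>m (S * Vc)) (S * Uc)"
    unfolding Sd_def W_def
    by (subst mult_four_block_mat[of _ r r _ r _ r _ _ N _ N])
      (use c in \<open>auto simp: mult_smult_distrib[of _ r r _ N]\<close>)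
  have t3: "mat_adjoint A * (S * B) \<in> carrier_mat N N" if "A \<in> carrier_mat r N" "B \<in> carrier_mat r N" for A B
    using mult_carrier_mat[OF mat_adjoint_carrier[OF that(1)] mult_carrier_mat[OF S that(2)]] .
  have hW: "mat_adjoint W * (Sd * W) = h"
    unfolding h SdW Wa
    by (subst mult_four_block_mat[of _ N r _ r _ N _ _ N _ N])
      (use c in \<open>auto simp: mult_smult_distrib[of _ N r _ N] mult_smult_assoc_mat[of _ N r _ N]
        smult_smult_mat power2_eq_square add_smult_distrib_left_mat[OF t3 t3]\<close>)
  have XY: "tau_z N * h = (tau_z N * mat_adjoint W) * (Sd * W)"
    unfolding hW[symmetric] by (rule assoc_mult_mat[OF tau_z_carrier W' mult_carrier_mat[OF Sd W], symmetric])
  have Xb: "tau_z N * mat_adjoint W = four_block_mat ?Ua (?s \<cdot>\<^sub>m ?Vca) (- (?s \<cdot>\<^sub>m ?Va)) (- ?Uca)"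
    unfolding Wa by (rule tau_z_mult_four_block) (use c in auto)
  have UV': "Vc * mat_adjoint U = Uc * mat_adjoint V"
    using arg_cong[OF UV, of mat_adjoint] c
    by (simp add: mat_adjoint_mult[of _ r N _ r])
  \<comment> \<open>Writing \<open>A'\<close> and \<open>B'\<close> for the adjoints, inserting
    \<open>A A' = 1 + B B'\<close> into \<open>A A' - s\<^sup>2 B B'\<close> leaves
    \<open>1 + (1 - s\<^sup>2) B B'\<close>, which is at least 1 for \<open>s\<close> between 0 and
    1. This lower bound keeps the gap open along the path.\<close>
  define G where "G A = 1\<^sub>m r + (1 - ?s\<^sup>2) \<cdot>\<^sub>m (A * mat_adjoint A)" for A
  have G: "A * mat_adjoint A - ?s\<^sup>2 \<cdot>\<^sub>m (B * mat_adjoint B) = G B"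
    if "A \<in> carrier_mat r N" "B \<in> carrier_mat r N" "A * mat_adjoint A - B * mat_adjoint B = 1\<^sub>m r" for A B
  proof -
    define AA BB where "AA = A * mat_adjoint A" and "BB = B * mat_adjoint B"
    have c': "AA \<in> carrier_mat r r" "BB \<in> carrier_mat r r" using that by (auto simp: AA_def BB_def)
    have "AA $$ (i,j) = 1\<^sub>m r $$ (i,j) + BB $$ (i,j)" if "i < r" "j < r" for i j
    proof -
      have "(AA - BB) $$ (i,j) = 1\<^sub>m r $$ (i,j)"
        using \<open>A * mat_adjoint A - B * mat_adjoint B = 1\<^sub>m r\<close> by (simp add: AA_def BB_def)
      then show ?thesis using that c' by (simp add: diff_eq_eq)
    qed
    then show ?thesis unfolding G_def AA_def[symmetric] BB_def[symmetric]
      using c' by (intro eq_matI) (auto simp: algebra_simps)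
  qed
  have Gc: "G A \<in> carrier_mat r r" if "A \<in> carrier_mat r N" for A using that by (auto simp: G_def)
  have WX: "W * (tau_z N * mat_adjoint W) = four_block_mat (G V) (0\<^sub>m r r) (0\<^sub>m r r) (- G Vc)"
  proof -
    have 1: "U * ?Ua + (?s \<cdot>\<^sub>m V) * (- (?s \<cdot>\<^sub>m ?Va)) = G V"
      unfolding G[OF U V UU, symmetric] using c
      by (simp add: mult_smult_distrib[of _ r N _ r] mult_smult_assoc_mat[of _ r N _ r] smult_smult_mat power2_eq_square)
        (intro eq_matI, auto)
    \<comment> \<open>Both terms carry exactly one factor \<open>s\<close>, so the relation
      \<open>UV\<close> of the unscaled rows cancels them for every \<open>s\<close>. The same
      happens in the lower left block with the adjoint relation \<open>UV'\<close>.\<close>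
    have 2: "U * (?s \<cdot>\<^sub>m ?Vca) + (?s \<cdot>\<^sub>m V) * (- ?Uca) = 0\<^sub>m r r"
      using c by (simp add: mult_smult_distrib[of _ r N _ r] mult_smult_assoc_mat[of _ r N _ r] UV)
        (intro eq_matI, auto)
    have 3: "(?s \<cdot>\<^sub>m Vc) * ?Ua + Uc * (- (?s \<cdot>\<^sub>m ?Va)) = 0\<^sub>m r r"
      using c by (simp add: mult_smult_distrib[of _ r N _ r] mult_smult_assoc_mat[of _ r N _ r] UV')
        (intro eq_matI, auto)
    have 4: "(?s \<cdot>\<^sub>m Vc) * (?s \<cdot>\<^sub>m ?Vca) + Uc * (- ?Uca) = - G Vc"
      unfolding G[OF Uc Vc UcUc, symmetric] using c
      by (simp add: mult_smult_distrib[of _ r N _ r] mult_smult_assoc_mat[of _ r N _ r] smult_smult_mat power2_eq_square)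
        (intro eq_matI, auto)
    show ?thesis unfolding Xb unfolding W_def
      by (subst mult_four_block_mat[of _ r N _ N _ r _ _ r _ r]) (use c 1 2 3 4 in auto)
  qed
  have ZZ: "1\<^sub>m (r + r) + Z * mat_adjoint Z = four_block_mat (G V) (0\<^sub>m r r) (0\<^sub>m r r) (G Vc)"
  proof -
    have Za: "mat_adjoint Z = four_block_mat (t \<cdot>\<^sub>m ?Va) (0\<^sub>m N r) (0\<^sub>m N r) (t \<cdot>\<^sub>m ?Vca)"
    proof -
      have z: "mat_adjoint (0\<^sub>m r N :: complex mat) = 0\<^sub>m N r" by (intro eq_matI) auto
      show ?thesis
        unfolding Z_def by (subst mat_adjoint_four_block[of _ r N _ N _ r]) (use c z t2 in \<open>auto simp: mat_adjoint_smult\<close>)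
    qed
    have "Z * mat_adjoint Z = four_block_mat ((1 - ?s\<^sup>2) \<cdot>\<^sub>m (V * ?Va)) (0\<^sub>m r r) (0\<^sub>m r r) ((1 - ?s\<^sup>2) \<cdot>\<^sub>m (Vc * ?Vca))"
      unfolding Za unfolding Z_def t2(1)[symmetric]
      by (subst mult_four_block_mat[of _ r N _ N _ r _ _ r _ r])
       (use c in \<open>auto simp: mult_smult_distrib[of _ r N _ r] mult_smult_assoc_mat[of _ r N _ r] smult_smult_mat\<close>)
    then show ?thesis
      unfolding four_block_one_mat[symmetric] G_def
      by (simp only:) (subst add_four_block_mat[of _ r r _ r _ r], use c in auto)
  qed
  have YX: "(Sd * W) * (tau_z N * mat_adjoint W) = J * (1\<^sub>m (r + r) + Z * mat_adjoint Z)"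
  proof -
    have "(Sd * W) * (tau_z N * mat_adjoint W) = Sd * (W * (tau_z N * mat_adjoint W))"
      by (rule assoc_mult_mat[OF Sd W mult_carrier_mat[OF tau_z_carrier W']])
    also have "\<dots> = four_block_mat (S * G V) (0\<^sub>m r r) (0\<^sub>m r r) (S * - G Vc)"
      unfolding WX Sd_def by (rule mult_block_diag) (use S Gc[OF V] Gc[OF Vc] in auto)
    also have "S * - G Vc = - S * G Vc" using S Gc[OF Vc] by simp
    also have "four_block_mat (S * G V) (0\<^sub>m r r) (0\<^sub>m r r) (- S * G Vc) = J * (1\<^sub>m (r + r) + Z * mat_adjoint Z)"
      unfolding ZZ J_def by (rule mult_block_diag[symmetric]) (use S Gc[OF V] Gc[OF Vc] in auto)
    finally show ?thesis .
  qed
  have Jherm: "mat_adjoint J = J"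
  proof -
    have z: "mat_adjoint (0\<^sub>m r r :: complex mat) = 0\<^sub>m r r" by (intro eq_matI) auto
    have m: "mat_adjoint (- S) = - S" by (subst (2) Sherm[symmetric]) (intro eq_matI, use S in auto)
    show ?thesis
      unfolding J_def by (subst mat_adjoint_four_block[of _ r r _ r _ r]) (use S z m Sherm in auto)
  qed
  have Jinv: "J * J = 1\<^sub>m (r + r)"
  proof -
    have "- S * - S = 1\<^sub>m r" using S Sinv by simp
    then show ?thesis unfolding J_def four_block_one_mat[symmetric]
      by (subst mult_block_diag) (use S Sinv in auto)
  qed
  note * = semisimple_product[OF mult_carrier_mat[OF tau_z_carrier W'] mult_carrier_mat[OF Sd W] J Z Jherm Jinv YX]
  show "diagonalizable (tau_z N * h)" unfolding XY by (rule *(1))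
  show "c \<in> \<real> \<and> (c = 0 \<or> 1 \<le> cmod c)" if "eigenvalue (tau_z N * h) c"
    using that unfolding XY by (rule *(2))
qed

section \<open>Stacked rows of both species and their sign matrix\<close>

lemma append_rows_mult_adjoint:
  fixes A B C D :: "complex mat"
  assumes A: "A \<in> carrier_mat r1 N" and B: "B \<in> carrier_mat r2 N"
    and C: "C \<in> carrier_mat r1 N" and D: "D \<in> carrier_mat r2 N"
  shows "(A @\<^sub>r B) * mat_adjoint (C @\<^sub>r D) =
    four_block_mat (A * mat_adjoint C) (A * mat_adjoint D) (B * mat_adjoint C) (B * mat_adjoint D)"
proof -
  have z: "(0\<^sub>m r 0 :: complex mat) * mat_adjoint (0\<^sub>m r' 0) = 0\<^sub>m r r'" for r r'
    by (intro eq_matI) (auto simp: scalar_prod_def)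
  show ?thesis unfolding append_rows_def
    by (subst mat_adjoint_four_block[of _ r1 N _ 0 _ r2], use C D in auto)
      (subst mult_four_block_mat[of _ r1 N _ 0 _ r2 _ _ r1 _ r2], use A B C D z in auto)
qed

definition sign_mat :: "nat \<Rightarrow> nat \<Rightarrow> complex mat" where
  "sign_mat p q = four_block_mat (1\<^sub>m p) (0\<^sub>m p q) (0\<^sub>m q p) (- 1\<^sub>m q)"

lemma sign_mat:
  shows sign_mat_carrier: "sign_mat p q \<in> carrier_mat (p + q) (p + q)"
    and sign_mat_adjoint: "mat_adjoint (sign_mat p q) = sign_mat p q"
    and sign_mat_square: "sign_mat p q * sign_mat p q = 1\<^sub>m (p + q)"
proof -
  show "sign_mat p q \<in> carrier_mat (p + q) (p + q)" by (auto simp: sign_mat_def)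
  show "mat_adjoint (sign_mat p q) = sign_mat p q" by (intro eq_matI) (auto simp: sign_mat_def)
  have "- 1\<^sub>m q * - 1\<^sub>m q = (1\<^sub>m q :: complex mat)" by simp
  then show "sign_mat p q * sign_mat p q = 1\<^sub>m (p + q)"
    unfolding sign_mat_def four_block_one_mat[symmetric] by (subst mult_block_diag) auto
qed

text \<open>The sign matrix negates the second group of rows. This turns a difference of Gram
  products into one product with a Hermitian involution in the middle, the shape used in
  \<open>bdg_gram_spectrum\<close>.\<close>

lemma append_rows_sign_gram:
  fixes A B C D :: "complex mat"
  assumes A: "A \<in> carrier_mat r1 N" and B: "B \<in> carrier_mat r2 N"
    and C: "C \<in> carrier_mat r1 N" and D: "D \<in> carrier_mat r2 N"
  shows "mat_adjoint (A @\<^sub>r B) * (sign_mat r1 r2 * (C @\<^sub>r D)) = mat_adjoint A * C - mat_adjoint B * D"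
proof -
  have S: "sign_mat r1 r2 * (C @\<^sub>r D) = C @\<^sub>r (- D)"
    unfolding append_rows_def sign_mat_def
    by (subst mult_four_block_mat[of _ r1 r1 _ r2 _ r2 _ _ N _ 0]) (use C D in auto)
  have E: "mat_adjoint (A @\<^sub>r B) * (C @\<^sub>r (- D)) = four_block_mat (mat_adjoint A * C + mat_adjoint B * - D) (0\<^sub>m N 0) (0\<^sub>m 0 N) (0\<^sub>m 0 0)"
    unfolding append_rows_def
    by (subst mat_adjoint_four_block[of _ r1 N _ 0 _ r2], use A B in auto)
      (subst mult_four_block_mat[of _ N r1 _ r2 _ 0 _ _ N _ 0], use A B C D in auto)
  show ?thesis unfolding S E using A B C D by (intro eq_matI) auto
qed

subsection \<open>Smoothness\<close>

lemma Ck_fun_continuous: "Ck_fun n f \<Longrightarrow> continuous_on UNIV f"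
  by (cases n) auto

lemma Ck_fun_add: "Ck_fun n f \<Longrightarrow> Ck_fun n g \<Longrightarrow> Ck_fun n (\<lambda>x. f x + g x)"
proof (induction n arbitrary: f g)
  case (Suc n)
  have "\<exists>d. (\<forall>x. ((\<lambda>t. f (x + t *\<^sub>R b) + g (x + t *\<^sub>R b)) has_vector_derivative d x) (at 0)) \<and> Ck_fun n d"
    if b: "b \<in> Basis" for b
  proof -
    from Suc.prems b obtain f' g'
      where f': "\<And>x. ((\<lambda>t. f (x + t *\<^sub>R b)) has_vector_derivative f' x) (at 0)" "Ck_fun n f'"
        and g': "\<And>x. ((\<lambda>t. g (x + t *\<^sub>R b)) has_vector_derivative g' x) (at 0)" "Ck_fun n g'"
      by (metis Ck_fun.simps(2))
    show ?thesis
      by (intro exI[of _ "\<lambda>x. f' x + g' x"] conjI allI has_vector_derivative_add f'(1) g'(1) Suc.IH[OF f'(2) g'(2)])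
  qed
  then show ?case using Suc.prems by (auto intro: continuous_intros)
qed (auto intro: continuous_intros)

text \<open>Linearity is over the reals, so complex conjugation is covered together with negation
  and multiplication by a constant.\<close>

lemma Ck_fun_bounded_linear:
  assumes L: "bounded_linear L"
  shows "Ck_fun n f \<Longrightarrow> Ck_fun n (\<lambda>x. L (f x))"
proof (induction n arbitrary: f)
  case (Suc n)
  have "\<exists>d. (\<forall>x. ((\<lambda>t. L (f (x + t *\<^sub>R b))) has_vector_derivative d x) (at 0)) \<and> Ck_fun n d"
    if b: "b \<in> Basis" for b
  proof -
    from Suc.prems b obtain f'
      where f': "\<And>x. ((\<lambda>t. f (x + t *\<^sub>R b)) has_vector_derivative f' x) (at 0)" "Ck_fun n f'"
      by (metis Ck_fun.simps(2))
    show ?thesis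
      by (intro exI[of _ "\<lambda>x. L (f' x)"] conjI allI bounded_linear.has_vector_derivative[OF L] f'(1) Suc.IH[OF f'(2)])
  qed
  then show ?case using Suc.prems by (auto intro: bounded_linear.continuous_on[OF L])
qed (auto intro: bounded_linear.continuous_on[OF L])

text \<open>Needed for the blocks evaluated at \<open>-k\<close>. A partial derivative of the
  reflected function is the negated reflection of the original derivative, so the induction
  hypothesis combines with closure under negation.\<close>

lemma Ck_fun_reflect: "Ck_fun n f \<Longrightarrow> Ck_fun n (\<lambda>x. f (-x))"
proof (induction n arbitrary: f)
  case 0
  then show ?case by (auto intro!: continuous_on_compose2[of UNIV f] continuous_intros)
next
  case (Suc n)
  have "\<exists>d. (\<forall>x. ((\<lambda>t. f (- (x + t *\<^sub>R b))) has_vector_derivative d x) (at 0)) \<and> Ck_fun n d"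
    if b: "b \<in> Basis" for b
  proof -
    from Suc.prems b obtain f'
      where f': "\<And>x. ((\<lambda>t. f (x + t *\<^sub>R b)) has_vector_derivative f' x) (at 0)" "Ck_fun n f'"
      by (metis Ck_fun.simps(2))
    have "((\<lambda>t. f (- (x + t *\<^sub>R b))) has_vector_derivative - f' (-x)) (at 0)" for x
    proof -
      have "((\<lambda>t::real. - t) has_vector_derivative -1) (at 0)"
        by (auto intro!: derivative_eq_intros)
      \<comment> \<open>The base point is written \<open>- 0\<close> because the chain rule asks for
        the derivative at the image of 0 under negation.\<close>
      moreover have "((\<lambda>t. f (-x + t *\<^sub>R b)) has_vector_derivative f' (-x)) (at (- 0))"
        using f'(1)[of "-x"] by simp
      ultimately have "((\<lambda>t. f (-x + t *\<^sub>R b)) \<circ> (\<lambda>t. -t) has_vector_derivative -1 *\<^sub>R f' (-x)) (at 0)"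
        by (rule vector_diff_chain_at)
      moreover have "(\<lambda>t. f (-x + t *\<^sub>R b)) \<circ> (\<lambda>t. -t) = (\<lambda>t. f (- (x + t *\<^sub>R b)))"
        by (rule ext) (simp only: o_def minus_add_distrib scaleR_minus_left)
      ultimately show ?thesis by simp
    qed
    moreover have "Ck_fun n (\<lambda>x. - f' (-x))"
      using Ck_fun_bounded_linear[OF bounded_linear_minus[OF bounded_linear_ident] Suc.IH[OF f'(2)]] by simp
    ultimately show ?thesis by (intro exI[of _ "\<lambda>x. - f' (-x)"]) simp
  qed
  then show ?case using Suc.prems by (auto intro!: continuous_on_compose2[of UNIV f] continuous_intros)
qed

lemma smooth_fun_continuous: "smooth_fun f \<Longrightarrow> continuous_on UNIV f"
  unfolding smooth_fun_def using Ck_fun_continuous by blast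

lemma smooth_fun_add: "smooth_fun f \<Longrightarrow> smooth_fun g \<Longrightarrow> smooth_fun (\<lambda>x. f x + g x)"
  unfolding smooth_fun_def using Ck_fun_add by blast

lemma smooth_fun_bounded_linear: "bounded_linear L \<Longrightarrow> smooth_fun f \<Longrightarrow> smooth_fun (\<lambda>x. L (f x))"
  unfolding smooth_fun_def using Ck_fun_bounded_linear by blast

lemma smooth_fun_diff: "smooth_fun f \<Longrightarrow> smooth_fun g \<Longrightarrow> smooth_fun (\<lambda>x. f x - g x)"
  using smooth_fun_add[of f "\<lambda>x. - g x"] smooth_fun_bounded_linear[OF bounded_linear_minus[OF bounded_linear_ident], of g]
  by simp

lemma smooth_fun_reflect: "smooth_fun f \<Longrightarrow> smooth_fun (\<lambda>x. f (-x))"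
  unfolding smooth_fun_def using Ck_fun_reflect by blast

lemma smooth_fun_zero: "smooth_fun (\<lambda>x :: 'd :: euclidean_space. 0)"
proof -
  have "Ck_fun n (\<lambda>x :: 'd. 0)" for n
  proof (induction n)
    case (Suc n)
    have "((\<lambda>t. 0) has_vector_derivative (0 :: complex)) (at (0::real))" by simp
    with Suc show ?case by (auto intro!: exI[of _ "\<lambda>x. 0"])
  qed simp
  then show ?thesis by (simp add: smooth_fun_def)
qed

lemma smooth_signed_gram:
  assumes a: "\<And>\<sigma> k. a \<sigma> k \<in> carrier_mat (R \<sigma>) N" and b: "\<And>\<sigma> k. b \<sigma> k \<in> carrier_mat (R \<sigma>) N"
    and ab: "\<And>\<sigma>. smooth_mat N N (\<lambda>k. mat_adjoint (a \<sigma> k) * b \<sigma> k)"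
  shows "smooth_mat N N (signed_gram a b)"
  unfolding smooth_mat_def
proof (intro allI impI)
  fix i j assume ij: "i < N" "j < N"
  have "smooth_fun (\<lambda>k. (mat_adjoint (a True k) * b True k) $$ (i,j) - (mat_adjoint (a False k) * b False k) $$ (i,j))"
    using ab ij by (intro smooth_fun_diff) (auto simp: smooth_mat_def)
  moreover have "signed_gram a b k $$ (i,j) =
      (mat_adjoint (a True k) * b True k) $$ (i,j) - (mat_adjoint (a False k) * b False k) $$ (i,j)" for k
    unfolding signed_gram_def
    by (rule index_minus_mat) (use ij a[of False k] b[of False k] in auto)
  ultimately show "smooth_fun (\<lambda>k. signed_gram a b k $$ (i,j))" by simp
qed

text \<open>Each Gram product picks up one factor \<open>s\<close> per occurrence of
  \<open>v\<close>, and conjugation leaves the real \<open>s\<close> unchanged. Both summands of a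
  mixed block carry the same factor, so it can be pulled out.\<close>

lemma bdg_H_scaled_blocks:
  fixes s :: real
  assumes u: "\<And>\<sigma> k. u \<sigma> k \<in> carrier_mat (R \<sigma>) N" and v: "\<And>\<sigma> k. v \<sigma> k \<in> carrier_mat (R \<sigma>) N"
  shows "bdg_H N u (\<lambda>\<sigma> k. of_real s \<cdot>\<^sub>m v \<sigma> k) k = four_block_mat
      (signed_gram u u k + (of_real s)\<^sup>2 \<cdot>\<^sub>m transpose_mat (signed_gram v v (-k)))
      (of_real s \<cdot>\<^sub>m (signed_gram u v k + transpose_mat (signed_gram u v (-k))))
      (of_real s \<cdot>\<^sub>m (signed_gram v u k + transpose_mat (signed_gram v u (-k))))
      ((of_real s)\<^sup>2 \<cdot>\<^sub>m signed_gram v v k + transpose_mat (signed_gram u u (-k)))"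
proof -
  let ?v = "\<lambda>\<sigma> k. complex_of_real s \<cdot>\<^sub>m v \<sigma> k"
  have v': "?v \<sigma> k \<in> carrier_mat (R \<sigma>) N" for \<sigma> k using v by simp
  have tr: "transpose_mat (c \<cdot>\<^sub>m A) = c \<cdot>\<^sub>m transpose_mat A" for c and A :: "complex mat"
    by (intro eq_matI) auto
  note cs = signed_gram_carrier[of u R N v, OF u v] signed_gram_carrier[of v R N u, OF v u]
  show ?thesis
    unfolding bdg_H_blocks[of u R N ?v, OF u v']
      signed_gram_smult(1)[of u R N v, OF u v] signed_gram_smult(2)[of v R N u, OF v u]
      signed_gram_smult(1)[of ?v R N v, OF v' v] signed_gram_smult(2)[of v R N v, OF v v]
      tr smult_smult_mat
    by (simp add: power2_eq_square add_smult_distrib_left_mat[of _ N N] cs)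
qed

text \<open>The coefficients of this quadratic polynomial in \<open>s\<close> are smooth and
  independent of \<open>s\<close>. The one form yields both joint continuity of the path and
  smoothness at each of its points.\<close>

lemma bdg_H_scaled_entry:
  fixes u v :: "bool \<Rightarrow> 'd::euclidean_space \<Rightarrow> complex mat"
  assumes u: "\<And>\<sigma> k. u \<sigma> k \<in> carrier_mat (R \<sigma>) N" and v: "\<And>\<sigma> k. v \<sigma> k \<in> carrier_mat (R \<sigma>) N"
    and uu: "smooth_mat N N (signed_gram u u)" and uv: "smooth_mat N N (signed_gram u v)"
    and vu: "smooth_mat N N (signed_gram v u)" and vv: "smooth_mat N N (signed_gram v v)"
    and ij: "i < 2 * N" "j < 2 * N"
  obtains f g l where "smooth_fun f" "smooth_fun g" "smooth_fun l"
    "\<And>(s :: real) k. bdg_H N u (\<lambda>\<sigma> k. of_real s \<cdot>\<^sub>m v \<sigma> k) k $$ (i, j) = f k + of_real s * g k + (of_real s)\<^sup>2 * l k"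
proof -
  have entry: "smooth_fun (\<lambda>k. F k $$ (p, q))" "smooth_fun (\<lambda>k. F (-k) $$ (p, q))"
    if "smooth_mat N N F" "p < N" "q < N" for F :: "'d \<Rightarrow> complex mat" and p q
    using that smooth_fun_reflect[of "\<lambda>k. F k $$ (p,q)"] by (auto simp: smooth_mat_def)
  note cs = signed_gram_carrier[of u R N u, OF u u] signed_gram_carrier[of u R N v, OF u v]
    signed_gram_carrier[of v R N u, OF v u] signed_gram_carrier[of v R N v, OF v v]
  note ds = carrier_matD[OF cs(1)] carrier_matD[OF cs(2)] carrier_matD[OF cs(3)] carrier_matD[OF cs(4)]
  note B = bdg_H_scaled_blocks[of u R N v, OF u v]
  consider "i < N" "j < N" | "i < N" "j \<ge> N" "j - N < N" | "i \<ge> N" "i - N < N" "j < N"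
    | "i \<ge> N" "i - N < N" "j \<ge> N" "j - N < N"
    using ij by linarith
  then show ?thesis
  proof cases
    case 1
    show ?thesis
      by (rule that[of "\<lambda>k. signed_gram u u k $$ (i,j)" "\<lambda>k. 0" "\<lambda>k. signed_gram v v (-k) $$ (j,i)"])
        (use 1 entry uu vv smooth_fun_zero in \<open>auto simp: B ds\<close>)
  next
    case 2
    show ?thesis
      by (rule that[of "\<lambda>k. 0" "\<lambda>k. signed_gram u v k $$ (i,j-N) + signed_gram u v (-k) $$ (j-N,i)" "\<lambda>k. 0"])
        (use 2 ij entry uv smooth_fun_zero in \<open>auto simp: B ds intro!: smooth_fun_add\<close>)
  next
    case 3
    show ?thesis
      by (rule that[of "\<lambda>k. 0" "\<lambda>k. signed_gram v u k $$ (i-N,j) + signed_gram v u (-k) $$ (j,i-N)" "\<lambda>k. 0"])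
        (use 3 ij entry vu smooth_fun_zero in \<open>auto simp: B ds intro!: smooth_fun_add\<close>)
  next
    case 4
    show ?thesis
      by (rule that[of "\<lambda>k. signed_gram u u (-k) $$ (j-N,i-N)" "\<lambda>k. 0" "\<lambda>k. signed_gram v v k $$ (i-N,j-N)"])
        (use 4 ij entry uu vv smooth_fun_zero in \<open>auto simp: B ds\<close>)
  qed
qed

subsection \<open>The deformation\<close>

lemma map_cnj_carrier: "A \<in> carrier_mat n m \<Longrightarrow> map_mat cnj A \<in> carrier_mat n m"
  by simp

lemma adjoint_map_cnj: "mat_adjoint (map_mat cnj A) = transpose_mat A"
  by (intro eq_matI) auto

lemma transpose_adjoint_mult:
  fixes A B :: "complex mat"
  assumes "A \<in> carrier_mat n m" "B \<in> carrier_mat n l"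
  shows "transpose_mat (mat_adjoint A * B) = mat_adjoint (map_mat cnj B) * map_mat cnj A"
  using assms by (intro eq_matI) (auto simp: scalar_prod_def mult.commute intro!: sum.cong)

lemma map_cnj_mult_adjoint:
  fixes A B :: "complex mat"
  assumes "A \<in> carrier_mat n m" "B \<in> carrier_mat l m"
  shows "map_mat cnj A * mat_adjoint (map_mat cnj B) = map_mat cnj (A * mat_adjoint B)"
  using assms by (intro eq_matI) (auto simp: scalar_prod_def intro!: sum.cong)

text \<open>Presents the transposed blocks again as Gram differences, now of conjugated rows, so
  that \<open>append_rows_sign_gram\<close> also applies to the particle-hole half.\<close>

lemma transpose_signed_gram:
  assumes a: "\<And>\<sigma> k. a \<sigma> k \<in> carrier_mat (R \<sigma>) N" and b: "\<And>\<sigma> k. b \<sigma> k \<in> carrier_mat (R \<sigma>) N"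
  shows "transpose_mat (signed_gram a b k) =
    mat_adjoint (map_mat cnj (b True k)) * map_mat cnj (a True k) - mat_adjoint (map_mat cnj (b False k)) * map_mat cnj (a False k)"
proof -
  have "transpose_mat (A - B) = transpose_mat A - transpose_mat B"
    if "A \<in> carrier_mat N N" "B \<in> carrier_mat N N" for A B :: "complex mat"
    using that by (intro eq_matI) auto
  note tm = this[OF mult_carrier_mat[OF mat_adjoint_carrier[OF a[of True k]] b[of True k]]
      mult_carrier_mat[OF mat_adjoint_carrier[OF a[of False k]] b[of False k]]]
  show ?thesis unfolding signed_gram_def tm
    transpose_adjoint_mult[OF a[of True k] b[of True k]] transpose_adjoint_mult[OF a[of False k] b[of False k]] ..
qed

lemma minus_mat_eq_zeroD:
  fixes A B :: "'a :: ab_group_add mat"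
  assumes A: "A \<in> carrier_mat n m" and B: "B \<in> carrier_mat n m" and eq: "A - B = 0\<^sub>m n m"
  shows "A = B"
proof (rule eq_matI)
  fix i j assume ij: "i < dim_row B" "j < dim_col B"
  have "(A - B) $$ (i,j) = 0" using ij B unfolding eq by simp
  then show "A $$ (i,j) = B $$ (i,j)" using ij by simp
qed (use A B in auto)

text \<open>Stacking both species reduces this to \<open>bdg_gram_spectrum\<close>. The relation
  \<open>comm1\<close> enters twice, at \<open>k\<close> for the rows themselves and, conjugated, at
  \<open>-k\<close> for their particle-hole partners; \<open>comm2\<close> relates the two
  halves.\<close>

lemma bdg_H_scaled_spectrum:
  fixes u v :: "bool \<Rightarrow> 'd::euclidean_space \<Rightarrow> complex mat" and s :: real
  assumes u: "\<And>\<sigma> k. u \<sigma> k \<in> carrier_mat (R \<sigma>) N" and v: "\<And>\<sigma> k. v \<sigma> k \<in> carrier_mat (R \<sigma>) N"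
    and comm1: "\<And>\<sigma> \<sigma>' k. u \<sigma> k * mat_adjoint (u \<sigma>' k) - v \<sigma> k * mat_adjoint (v \<sigma>' k)
                    = (if \<sigma> = \<sigma>' then 1\<^sub>m (R \<sigma>) else 0\<^sub>m (R \<sigma>) (R \<sigma>'))"
    and comm2: "\<And>\<sigma> \<sigma>' k. u \<sigma> k * transpose_mat (v \<sigma>' (-k)) - v \<sigma> k * transpose_mat (u \<sigma>' (-k))
                    = 0\<^sub>m (R \<sigma>) (R \<sigma>')"
    and s: "0 \<le> s" "s \<le> 1"
  shows "diagonalizable (dyn_mat N (bdg_H N u (\<lambda>\<sigma> k. of_real s \<cdot>\<^sub>m v \<sigma> k) k))"
    and "eigenvalue (dyn_mat N (bdg_H N u (\<lambda>\<sigma> k. of_real s \<cdot>\<^sub>m v \<sigma> k) k)) c \<Longrightarrow>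
      c \<in> \<real> \<and> (c = 0 \<or> 1 \<le> cmod c)"
proof -
  define p q where "p = R True" and "q = R False"
  note c = u[of True, folded p_def] u[of False, folded q_def] v[of True, folded p_def] v[of False, folded q_def]
  note cc = c[THEN map_cnj_carrier]
  define U V where "U = u True k @\<^sub>r u False k" and "V = v True k @\<^sub>r v False k"
  \<comment> \<open>The adjoint of the operator \<open>A\<close> at momentum \<open>-k\<close>, read
    in the Nambu basis at \<open>k\<close>, has the row \<open>[cnj v(-k), cnj u(-k)]\<close>. This
    explains both the conjugation and the reflected momentum.\<close>
  define Uc where "Uc = map_mat cnj (u True (-k)) @\<^sub>r map_mat cnj (u False (-k))"
  define Vc where "Vc = map_mat cnj (v True (-k)) @\<^sub>r map_mat cnj (v False (-k))"
  let ?S = "sign_mat p q"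
  have carr: "U \<in> carrier_mat (p + q) N" "V \<in> carrier_mat (p + q) N"
      "Uc \<in> carrier_mat (p + q) N" "Vc \<in> carrier_mat (p + q) N"
    unfolding U_def V_def Uc_def Vc_def using c cc by auto
  have UU: "U * mat_adjoint U - V * mat_adjoint V = 1\<^sub>m (p + q)"
  proof -
    have "U * mat_adjoint U - V * mat_adjoint V = four_block_mat
        (u True k * mat_adjoint (u True k) - v True k * mat_adjoint (v True k))
        (u True k * mat_adjoint (u False k) - v True k * mat_adjoint (v False k))
        (u False k * mat_adjoint (u True k) - v False k * mat_adjoint (v True k))
        (u False k * mat_adjoint (u False k) - v False k * mat_adjoint (v False k))"
      unfolding U_def V_def append_rows_mult_adjoint[OF c(1,2) c(1,2)] append_rows_mult_adjoint[OF c(3,4) c(3,4)]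
      using c(1,2,3,4)[of k] by (intro eq_matI) auto
    then show ?thesis unfolding comm1 by (simp add: p_def q_def)
  qed
  have UcUc: "Uc * mat_adjoint Uc - Vc * mat_adjoint Vc = 1\<^sub>m (p + q)"
  proof -
    have *: "map_mat cnj (u \<sigma> (-k)) * mat_adjoint (map_mat cnj (u \<sigma>' (-k))) - map_mat cnj (v \<sigma> (-k)) * mat_adjoint (map_mat cnj (v \<sigma>' (-k)))
       = map_mat cnj (if \<sigma> = \<sigma>' then 1\<^sub>m (R \<sigma>) else 0\<^sub>m (R \<sigma>) (R \<sigma>'))" for \<sigma> \<sigma>'
      unfolding comm1[of \<sigma> "-k" \<sigma>', symmetric] map_cnj_mult_adjoint[OF u u] map_cnj_mult_adjoint[OF v v]
      using u[of \<sigma> "-k"] u[of \<sigma>' "-k"] v[of \<sigma> "-k"] v[of \<sigma>' "-k"] by (intro eq_matI) (auto simp del: index_mult_mat(1))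
    have one: "map_mat cnj (1\<^sub>m n) = 1\<^sub>m n" "map_mat cnj (0\<^sub>m n m) = 0\<^sub>m n m" for n m by auto
    have "Uc * mat_adjoint Uc - Vc * mat_adjoint Vc = four_block_mat
        (map_mat cnj (u True (-k)) * mat_adjoint (map_mat cnj (u True (-k))) - map_mat cnj (v True (-k)) * mat_adjoint (map_mat cnj (v True (-k))))
        (map_mat cnj (u True (-k)) * mat_adjoint (map_mat cnj (u False (-k))) - map_mat cnj (v True (-k)) * mat_adjoint (map_mat cnj (v False (-k))))
        (map_mat cnj (u False (-k)) * mat_adjoint (map_mat cnj (u True (-k))) - map_mat cnj (v False (-k)) * mat_adjoint (map_mat cnj (v True (-k))))
        (map_mat cnj (u False (-k)) * mat_adjoint (map_mat cnj (u False (-k))) - map_mat cnj (v False (-k)) * mat_adjoint (map_mat cnj (v False (-k))))"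
      unfolding Uc_def Vc_def append_rows_mult_adjoint[OF cc(1,2) cc(1,2)] append_rows_mult_adjoint[OF cc(3,4) cc(3,4)]
      using c(1,2,3,4)[of "-k"] by (intro eq_matI) auto
    then show ?thesis unfolding * by (simp add: one p_def q_def)
  qed
  \<comment> \<open>The adjoint of a conjugated matrix is its transpose, so \<open>comm2\<close> is
    this identity block by block.\<close>
  have UV: "U * mat_adjoint Vc = V * mat_adjoint Uc"
  proof -
    have "u \<sigma> k * transpose_mat (v \<sigma>' (-k)) = v \<sigma> k * transpose_mat (u \<sigma>' (-k))" for \<sigma> \<sigma>'
      by (rule minus_mat_eq_zeroD[OF mult_carrier_mat[OF u transpose_carrier_mat[THEN iffD2, OF v]]
         mult_carrier_mat[OF v transpose_carrier_mat[THEN iffD2, OF u]] comm2])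
    then show ?thesis
      unfolding U_def V_def Uc_def Vc_def append_rows_mult_adjoint[OF c(1,2) cc(3,4)] append_rows_mult_adjoint[OF c(3,4) cc(1,2)]
        adjoint_map_cnj by simp
  qed
  note g = append_rows_sign_gram
  note tr = transpose_signed_gram[of u R N u, OF u u] transpose_signed_gram[of u R N v, OF u v]
    transpose_signed_gram[of v R N u, OF v u] transpose_signed_gram[of v R N v, OF v v]
  have h: "bdg_H N u (\<lambda>\<sigma> k. of_real s \<cdot>\<^sub>m v \<sigma> k) k = four_block_mat
      (mat_adjoint U * (?S * U) + (of_real s)\<^sup>2 \<cdot>\<^sub>m (mat_adjoint Vc * (?S * Vc)))
      (of_real s \<cdot>\<^sub>m (mat_adjoint U * (?S * V) + mat_adjoint Vc * (?S * Uc)))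
      (of_real s \<cdot>\<^sub>m (mat_adjoint V * (?S * U) + mat_adjoint Uc * (?S * Vc)))
      ((of_real s)\<^sup>2 \<cdot>\<^sub>m (mat_adjoint V * (?S * V)) + mat_adjoint Uc * (?S * Uc))"
    unfolding bdg_H_scaled_blocks[of u R N v, OF u v] tr U_def V_def Uc_def Vc_def
      g[OF c(1,2) c(1,2)] g[OF c(1,2) c(3,4)] g[OF c(3,4) c(1,2)] g[OF c(3,4) c(3,4)]
      g[OF cc(1,2) cc(1,2)] g[OF cc(1,2) cc(3,4)] g[OF cc(3,4) cc(1,2)] g[OF cc(3,4) cc(3,4)]
    unfolding signed_gram_def ..
  note * = bdg_gram_spectrum[OF carr sign_mat_carrier sign_mat_adjoint sign_mat_square s UU UcUc UV h, folded dyn_mat_def]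
  show "diagonalizable (dyn_mat N (bdg_H N u (\<lambda>\<sigma> k. of_real s \<cdot>\<^sub>m v \<sigma> k) k))" by (rule *(1))
  show "eigenvalue (dyn_mat N (bdg_H N u (\<lambda>\<sigma> k. of_real s \<cdot>\<^sub>m v \<sigma> k) k)) c \<Longrightarrow>
      c \<in> \<real> \<and> (c = 0 \<or> 1 \<le> cmod c)" by (rule *(2))
qed

theorem theorem1:
  fixes N :: nat and R :: "bool \<Rightarrow> nat"
    and u v :: "bool \<Rightarrow> 'd::euclidean_space \<Rightarrow> complex mat"
  assumes N_pos: "N \<ge> 1"
    and R_le: "R True + R False \<le> N"
    and u_dim: "\<And>\<sigma> k. u \<sigma> k \<in> carrier_mat (R \<sigma>) N"
    and v_dim: "\<And>\<sigma> k. v \<sigma> k \<in> carrier_mat (R \<sigma>) N"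
    and comm1: "\<And>\<sigma> \<sigma>' k. u \<sigma> k * mat_adjoint (u \<sigma>' k) - v \<sigma> k * mat_adjoint (v \<sigma>' k)
                    = (if \<sigma> = \<sigma>' then 1\<^sub>m (R \<sigma>) else 0\<^sub>m (R \<sigma>) (R \<sigma>'))"
    and comm2: "\<And>\<sigma> \<sigma>' k. u \<sigma> k * transpose_mat (v \<sigma>' (-k)) - v \<sigma> k * transpose_mat (u \<sigma>' (-k))
                    = 0\<^sub>m (R \<sigma>) (R \<sigma>')"
    and smooth_uu: "\<And>\<sigma>. smooth_mat N N (\<lambda>k. mat_adjoint (u \<sigma> k) * u \<sigma> k)"
    and smooth_vv: "\<And>\<sigma>. smooth_mat N N (\<lambda>k. mat_adjoint (v \<sigma> k) * v \<sigma> k)"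
    and smooth_uv: "\<And>\<sigma>. smooth_mat N N (\<lambda>k. mat_adjoint (u \<sigma> k) * v \<sigma> k)"
    and per_uu: "\<And>\<sigma>. bz_periodic (\<lambda>k. mat_adjoint (u \<sigma> k) * u \<sigma> k)"
    and per_vv: "\<And>\<sigma>. bz_periodic (\<lambda>k. mat_adjoint (v \<sigma> k) * v \<sigma> k)"
    and per_uv: "\<And>\<sigma>. bz_periodic (\<lambda>k. mat_adjoint (u \<sigma> k) * v \<sigma> k)"
  shows "\<exists>h :: real \<Rightarrow> 'd \<Rightarrow> complex mat.
           (\<forall>i<2*N. \<forall>j<2*N. continuous_on ({0..1} \<times> UNIV) (\<lambda>(e, k). h e k $$ (i, j)))
         \<and> h 0 = bdg_H N u v
         \<and> h 1 = bdg_Htilde N u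
         \<and> (\<forall>e\<in>{0..1}. is_bdg N (h e) \<and> bz_periodic (h e)
                        \<and> short_ranged N (h e) \<and> dyn_stable N (h e) \<and> gapped_half N (h e))"
proof -
  define h where "h e = bdg_H N u (\<lambda>\<sigma> k. of_real (1 - e) \<cdot>\<^sub>m v \<sigma> k)" for e :: real
  \<comment> \<open>The lower left block involves this product. As the adjoint of the product
    assumed smooth and periodic, it inherits smoothness through entrywise conjugation, and
    periodicity directly.\<close>
  have vu: "mat_adjoint (v \<sigma> k) * u \<sigma> k = mat_adjoint (mat_adjoint (u \<sigma> k) * v \<sigma> k)" for \<sigma> k
    using mat_adjoint_mult[OF mat_adjoint_carrier[OF u_dim] v_dim, of \<sigma> k k] by simp
  have smooth_vu: "smooth_mat N N (\<lambda>k. mat_adjoint (v \<sigma> k) * u \<sigma> k)" for \<sigma>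
    unfolding smooth_mat_def
  proof (intro allI impI)
    fix i j assume ij: "i < N" "j < N"
    have "smooth_fun (\<lambda>k. cnj ((mat_adjoint (u \<sigma> k) * v \<sigma> k) $$ (j, i)))"
      using smooth_uv[of \<sigma>] ij by (intro smooth_fun_bounded_linear[OF bounded_linear_cnj]) (simp add: smooth_mat_def)
    moreover have "(mat_adjoint (v \<sigma> k) * u \<sigma> k) $$ (i, j) = cnj ((mat_adjoint (u \<sigma> k) * v \<sigma> k) $$ (j, i))" for k
      unfolding vu using ij u_dim[of \<sigma> k] v_dim[of \<sigma> k] by (subst mat_adjoint_index) auto
    ultimately show "smooth_fun (\<lambda>k. (mat_adjoint (v \<sigma> k) * u \<sigma> k) $$ (i, j))" by simp
  qed
  note sg = smooth_signed_gram[of u R N u, OF u_dim u_dim smooth_uu] smooth_signed_gram[of u R N v, OF u_dim v_dim smooth_uv]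
    smooth_signed_gram[of v R N u, OF v_dim u_dim smooth_vu] smooth_signed_gram[of v R N v, OF v_dim v_dim smooth_vv]
  have entry: "\<exists>f g l. smooth_fun f \<and> smooth_fun g \<and> smooth_fun l \<and>
      (\<forall>e k. h e k $$ (i, j) = f k + of_real (1 - e) * g k + (of_real (1 - e))\<^sup>2 * l k)"
    if ij: "i < 2 * N" "j < 2 * N" for i j
    by (rule bdg_H_scaled_entry[of u R N v, OF u_dim v_dim sg ij]) (unfold h_def, blast)
  have cont: "continuous_on ({0..1} \<times> UNIV) (\<lambda>(e, k). h e k $$ (i, j))" if ij: "i < 2 * N" "j < 2 * N" for i j
  proof -
    from entry[OF ij] obtain f g l where fgl: "smooth_fun f" "smooth_fun g" "smooth_fun l"
      and h_eq: "\<And>e k. h e k $$ (i, j) = f k + of_real (1 - e) * g k + (of_real (1 - e))\<^sup>2 * l k" by blast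
    \<comment> \<open>The coefficients depend on the momentum alone, so they are continuous on the
      product through \<open>snd\<close>; the parameter enters only polynomially.\<close>
    have "continuous_on ({0..1} \<times> UNIV) (\<lambda>z :: real \<times> 'd. F (snd z))" if "smooth_fun F" for F
      by (rule continuous_on_compose2[OF smooth_fun_continuous[OF that]]) (auto intro: continuous_intros)
    note this[OF fgl(1)] this[OF fgl(2)] this[OF fgl(3)]
    then show ?thesis unfolding case_prod_unfold h_eq by (intro continuous_intros)
  qed
  have short: "short_ranged N (h e)" for e
    unfolding short_ranged_def smooth_mat_def
  proof (intro allI impI)
    fix i j assume "i < 2 * N" "j < 2 * N"
    from entry[OF this] obtain f g l where fgl: "smooth_fun f" "smooth_fun g" "smooth_fun l"
      and h_eq: "\<And>e k. h e k $$ (i, j) = f k + of_real (1 - e) * g k + (of_real (1 - e))\<^sup>2 * l k" by blast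
    show "smooth_fun (\<lambda>k. h e k $$ (i, j))"
      unfolding h_eq by (intro smooth_fun_add fgl smooth_fun_bounded_linear[OF bounded_linear_mult_right])
  qed
  have per: "bz_periodic (h e)" for e
  proof -
    have p: "signed_gram a b (k + (2 * pi) *\<^sub>R x) = signed_gram a b k"
        "signed_gram a b (- (k + (2 * pi) *\<^sub>R x)) = signed_gram a b (-k)"
      if x: "x \<in> Basis" and ab: "\<And>\<sigma>. bz_periodic (\<lambda>k. mat_adjoint (a \<sigma> k) * b \<sigma> k)" for a b x and k :: 'd
    proof -
      show *: "signed_gram a b (k + (2 * pi) *\<^sub>R x) = signed_gram a b k" for k
        using ab x unfolding signed_gram_def bz_periodic_def by simp
      \<comment> \<open>Shifting forward from \<open>- (k + 2 pi x)\<close> lands at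
        \<open>-k\<close>, so periodicity is applied at that point.\<close>
      show "signed_gram a b (- (k + (2 * pi) *\<^sub>R x)) = signed_gram a b (-k)"
        using *[of "- (k + (2 * pi) *\<^sub>R x)"] by simp
    qed
    have per_vu: "bz_periodic (\<lambda>k. mat_adjoint (v \<sigma> k) * u \<sigma> k)" for \<sigma>
      using per_uv[of \<sigma>] unfolding bz_periodic_def vu by simp
    show ?thesis
      unfolding bz_periodic_def h_def bdg_H_scaled_blocks[of u R N v, OF u_dim v_dim]
      by (intro allI ballI) (simp only: p[OF _ per_uu] p[OF _ per_uv] p[OF _ per_vu] p[OF _ per_vv])
  qed
  have bdg: "is_bdg N (h e)" for e
    unfolding h_def by (rule bdg_H_is_bdg[of u R]) (use u_dim v_dim in auto)
  have spec: "diagonalizable (dyn_mat N (h e k))"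
      "eigenvalue (dyn_mat N (h e k)) c \<Longrightarrow> c \<in> \<real> \<and> (c = 0 \<or> 1 \<le> cmod c)"
    if "e \<in> {0..1}" for e k c
    using bdg_H_scaled_spectrum[of u R N v "1 - e" k, OF u_dim v_dim comm1 comm2] that by (auto simp: h_def)
  have stable: "dyn_stable N (h e)" if "e \<in> {0..1}" for e
    using spec[OF that] unfolding dyn_stable_def by blast
  have gap: "gapped_half N (h e)" if e: "e \<in> {0..1}" for e
    unfolding gapped_half_def
  \<comment> \<open>The eigenvalue 0 lies at distance exactly 1/2 from both gap centres, and
    \<open>1 \<le> cmod c\<close> leaves at least \<open>1 - 1/2\<close> by the reverse triangle
    inequality; hence the constant.\<close>
  proof (intro exI[of _ "1/2"] conjI allI impI)
    fix k c assume "eigenvalue (dyn_mat N (h e k)) c"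
    then have "c = 0 \<or> 1 \<le> cmod c" using spec(2)[OF e] by blast
    then show "1/2 \<le> cmod (c - 1/2)" "1/2 \<le> cmod (c + 1/2)"
      using norm_triangle_ineq2[of c "1/2"] norm_diff_ineq[of c "1/2"] by auto
  qed simp
  have h0: "h 0 = bdg_H N u v"
  proof -
    have "1 \<cdot>\<^sub>m A = A" for A :: "complex mat" by (intro eq_matI) auto
    then show ?thesis by (simp add: h_def)
  qed
  have h1: "h 1 = bdg_Htilde N u"
    unfolding h_def using bdg_H_smult_zero[of u R N v, OF u_dim v_dim] by simp
  show ?thesis
    using cont h0 h1 bdg per short stable gap by (intro exI[of _ h]) blast
qed

end
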